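(* There is a randomized algorithm (called ExogLearnVal), running in polynomial time per round, such that for every valuation vector $v$ and every sequence of price vectors $p^1,\ldots,p^T$ (possibly chosen adaptively and adversarially), with probability at least $1-\beta$ the number of rounds $t$ with $\hat x^t\ne x^t$ is at most $O\!\left(n^2\log(1/\delta)+n\sqrt{\log(1/\beta)\log(1/\delta)}\right)$.
   Context: There are $n$ divisible goods. A bundle is a vector $x\in[0,1]^n$ and a price vector is $p\in[0,1]^n$. A consumer has a known budget $B\ge0$ and an unknown linear utility function $u(x)=x\cdot v$, where each $v_i\in\{0,\delta,2\delta,\ldots,1\}$ for a known discretization parameter $\delta>0$. Facing prices $p$, the consumer buys a bundle in $X(u,p,B)=\arg\max_{x\in[0,1]^n,\ x\cdot p\le B}u(x)$. In the exogenous price model, in each round $t=1,\ldots,T$ a price vector $p^t$ is revealed, the algorithm predicts a bundle $\hat x^t$, and then observes the bundle $x^t\in X(u,p^t,B)$ actually purchased; the algorithm makes a mistake in round $t$ if $\hat x^t\ne x^t$. $\beta\in(0,1)$ is a confidence parameter.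
   Formalization: If several bundles are optimal, the consumer is taken to buy the lexicographically greatest one (with arbitrary choices no bound holds: n=1, v=0, p=0); δ<1 is assumed, since at δ=1 the bound would be 0. Time is counted in unit-cost real arithmetic. *)

theory Defs
  imports
    "HOL-Probability.Probability_Mass_Function"
    "HOL-Computational_Algebra.Polynomial"
begin

section \<open>The consumer\<close>

text \<open>Bundles, price vectors and valuation vectors are lists of length \<open>n\<close>.\<close>

type_synonym vec = "real list"

definition cube :: "nat \<Rightarrow> vec set" where
  "cube n = {x. length x = n \<and> set x \<subseteq> {0..1}}"

definition dot :: "nat \<Rightarrow> vec \<Rightarrow> vec \<Rightarrow> real" where
  "dot n x y = (\<Sum>i<n. x ! i * y ! i)"

definition valuations :: "nat \<Rightarrow> real \<Rightarrow> vec set" where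
  "valuations n \<delta> = {v. length v = n \<and> set v \<subseteq> {real k * \<delta> | k. real k * \<delta> \<le> 1}}"

definition optimal_bundles :: "nat \<Rightarrow> vec \<Rightarrow> real \<Rightarrow> vec \<Rightarrow> vec set" where
  "optimal_bundles n v B p =
     {x. is_arg_max (\<lambda>x. dot n x v) (\<lambda>x. x \<in> cube n \<and> dot n x p \<le> B) x}"

text \<open>
  If the consumer could resolve ties in an arbitrary way, no algorithm would have a mistake bound:
  for \<open>n = 1\<close>, \<open>v = 0\<close>, \<open>p = 0\<close> every \<open>x\<close> in \<open>[0,1]\<close> is optimal. So ties are broken in a fixed way,
  in favour of the good with the smaller index: the bundle bought is the lexicographically greatest
  optimal one. Where the optimal bundle is unique, this is no restriction.
\<close>

definition purchased :: "nat \<Rightarrow> vec \<Rightarrow> real \<Rightarrow> vec \<Rightarrow> vec \<Rightarrow> bool" where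
  "purchased n v B p x \<longleftrightarrow>
     x \<in> optimal_bundles n v B p \<and>
     (\<forall>y \<in> optimal_bundles n v B p. y = x \<or> (y, x) \<in> lexord {(a, b). a < b})"


section \<open>Randomized real-number programs\<close>

text \<open>
  Prices and bundles are real vectors, and a prediction is correct only if it is exactly equal to
  the bundle bought, so running time is counted in a real-RAM model with unit-cost exact field
  operations and comparisons. A memory consists of numbered arrays of naturals (counters, indices)
  and of reals; a program mentions only finitely many of the array numbers. There are deliberately
  no real constants other than the naturals (a real constant could encode an infinite table), no
  rounding from reals to naturals, and no multiplication of naturals. \<open>Flip\<close> stores a fair
  random bit.
\<close>

type_synonym mem = "(nat \<Rightarrow> nat \<Rightarrow> nat) \<times> (nat \<Rightarrow> nat \<Rightarrow> real)"

datatype nexp =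
    NConst nat
  | NGet nat nexp
  | NAdd nexp nexp
  | NSub nexp nexp

datatype rexp =
    ROf nexp
  | RGet nat nexp
  | RAdd rexp rexp
  | RSub rexp rexp
  | RMul rexp rexp
  | RDiv rexp rexp

datatype bexp =
    NLess nexp nexp
  | RLess rexp rexp
  | BNot bexp
  | BAnd bexp bexp

datatype com =
    Skip
  | NSet nat nexp nexp
  | RSet nat nexp rexp
  | Flip nat nexp
  | Seq com com
  | Cond bexp com com
  | Loop bexp com

primrec nval :: "nexp \<Rightarrow> mem \<Rightarrow> nat" where
  "nval (NConst k) m = k"
| "nval (NGet a e) m = fst m a (nval e m)"
| "nval (NAdd e f) m = nval e m + nval f m"
| "nval (NSub e f) m = nval e m - nval f m"

primrec rval :: "rexp \<Rightarrow> mem \<Rightarrow> real" where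
  "rval (ROf e) m = real (nval e m)"
| "rval (RGet a e) m = snd m a (nval e m)"
| "rval (RAdd e f) m = rval e m + rval f m"
| "rval (RSub e f) m = rval e m - rval f m"
| "rval (RMul e f) m = rval e m * rval f m"
| "rval (RDiv e f) m = rval e m / rval f m"

primrec bval :: "bexp \<Rightarrow> mem \<Rightarrow> bool" where
  "bval (NLess e f) m = (nval e m < nval f m)"
| "bval (RLess e f) m = (rval e m < rval f m)"
| "bval (BNot b) m = (\<not> bval b m)"
| "bval (BAnd b c) m = (bval b m \<and> bval c m)"

definition nstore :: "nat \<Rightarrow> nat \<Rightarrow> nat \<Rightarrow> mem \<Rightarrow> mem" where
  "nstore a i k m = ((fst m)(a := (fst m a)(i := k)), snd m)"

definition rstore :: "nat \<Rightarrow> nat \<Rightarrow> real \<Rightarrow> mem \<Rightarrow> mem" where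
  "rstore a i r m = (fst m, (snd m)(a := (snd m a)(i := r)))"

text \<open>
  Each step evaluates at most one of the expressions of the program. Their sizes are
  constants of the program, so the number of steps is the running time up to a constant factor.
\<close>

primrec step :: "com \<Rightarrow> mem \<Rightarrow> (com \<times> mem) pmf" where
  "step Skip m = return_pmf (Skip, m)"
| "step (NSet a i e) m = return_pmf (Skip, nstore a (nval i m) (nval e m) m)"
| "step (RSet a i e) m = return_pmf (Skip, rstore a (nval i m) (rval e m) m)"
| "step (Flip a i) m =
     map_pmf (\<lambda>b. (Skip, nstore a (nval i m) (of_bool b) m)) (bernoulli_pmf (1 / 2))"
| "step (Seq c d) m =
     (if c = Skip then return_pmf (d, m)
      else map_pmf (\<lambda>(c', m'). (Seq c' d, m')) (step c m))"
| "step (Cond b c d) m = return_pmf (if bval b m then c else d, m)"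
| "step (Loop b c) m = return_pmf (if bval b m then Seq c (Loop b c) else Skip, m)"

primrec steps :: "nat \<Rightarrow> com \<Rightarrow> mem \<Rightarrow> (com \<times> mem) pmf" where
  "steps 0 c m = return_pmf (c, m)"
| "steps (Suc k) c m = bind_pmf (steps k c m) (\<lambda>(c', m'). step c' m')"

definition halts_within :: "nat \<Rightarrow> com \<Rightarrow> mem \<Rightarrow> bool" where
  "halts_within k c m \<longleftrightarrow> (\<forall>(c', m') \<in> set_pmf (steps k c m). c' = Skip)"

text \<open>
  The distribution of the final memory; only meaningful for programs that halt within some
  number of steps. By the lemma below, it does not matter which such number is chosen.
\<close>

definition exec :: "com \<Rightarrow> mem \<Rightarrow> mem pmf" where
  "exec c m = map_pmf snd (steps (LEAST k. halts_within k c m) c m)"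

lemma steps_add_halted:
  assumes "halts_within k c m"
  shows "steps (k + d) c m = steps k c m"
proof (induction d)
  case (Suc d)
  have "steps (k + Suc d) c m = bind_pmf (steps k c m) (\<lambda>(c', m'). step c' m')"
    using Suc by simp
  also have "\<dots> = bind_pmf (steps k c m) return_pmf"
    using assms by (intro bind_pmf_cong refl) (auto simp: halts_within_def)
  finally show ?case by (simp add: bind_return_pmf')
qed simp

lemma exec_eq:
  assumes "halts_within k c m"
  shows "exec c m = map_pmf snd (steps k c m)"
proof -
  let ?l = "LEAST k. halts_within k c m"
  have "halts_within ?l c m" and "?l \<le> k"
    using assms by (auto intro: LeastI Least_le)
  then show ?thesis
    using steps_add_halted[of ?l c m "k - ?l"] by (simp add: exec_def)
qed


section \<open>Exogenous prices\<close>

text \<open>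
  A learner is a pair of programs that communicate with each other and with later
  rounds through the memory. The first is run when the prices of a round are known and computes the
  prediction, the second is run when the purchase has been observed. The conventions for input and
  output are:
  \<^item> natural array 0, index 0: the number of goods \<open>n\<close>;
  \<^item> real array 0, indices 0, 1, 2: \<open>\<delta>\<close>, \<open>\<beta>\<close> and \<open>B\<close>;
  \<^item> real array 1: the current prices;
  \<^item> real array 2: the predicted bundle;
  \<^item> real array 3: the bundle bought.

  Neither program is told the valuation or the number of rounds.
\<close>

type_synonym learner = "com \<times> com"

definition initial_mem :: "nat \<Rightarrow> real \<Rightarrow> real \<Rightarrow> real \<Rightarrow> mem" where
  "initial_mem n \<delta> \<beta> B =
     nstore 0 0 n (rstore 0 0 \<delta> (rstore 0 1 \<beta> (rstore 0 2 B (\<lambda>_ _. 0, \<lambda>_ _. 0))))"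

definition write_vec :: "nat \<Rightarrow> vec \<Rightarrow> mem \<Rightarrow> mem" where
  "write_vec a x m =
     (fst m, (snd m)(a := (\<lambda>i. if i < length x then x ! i else snd m a i)))"

definition read_vec :: "nat \<Rightarrow> nat \<Rightarrow> mem \<Rightarrow> vec" where
  "read_vec n a m = map (snd m a) [0..<n]"

text \<open>A history lists, for each past round, the prices, the prediction and the purchase.\<close>

type_synonym history = "(vec \<times> vec \<times> vec) list"

definition mistakes :: "history \<Rightarrow> nat" where
  "mistakes h = card {t. t < length h \<and> (case h ! t of (p, xhat, x) \<Rightarrow> xhat \<noteq> x)}"

text \<open>
  \<open>adv\<close> chooses the prices depending on the history and \<open>buy\<close> maps prices to the bundle bought.
  The result is the joint distribution of history and memory after the given number of rounds.
\<close>

primrec play ::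
  "learner \<Rightarrow> (history \<Rightarrow> vec) \<Rightarrow> (vec \<Rightarrow> vec) \<Rightarrow> nat \<Rightarrow> mem \<Rightarrow> nat \<Rightarrow> (history \<times> mem) pmf"
where
  "play A adv buy n m0 0 = return_pmf ([], m0)"
| "play A adv buy n m0 (Suc t) =
     do {
       (h, m) \<leftarrow> play A adv buy n m0 t;
       let p = adv h;
       let x = buy p;
       m1 \<leftarrow> exec (fst A) (write_vec 1 p m);
       m2 \<leftarrow> exec (snd A) (write_vec 3 x m1);
       return_pmf (h @ [(p, read_vec n 2 m1, x)], m2)
     }"

text \<open>In round \<open>t\<close> (counted from 0), each of the two programs takes at most \<open>k\<close> steps, whatever
  the outcomes of the random bits so far.\<close>

definition round_time_le ::
  "nat \<Rightarrow> learner \<Rightarrow> (history \<Rightarrow> vec) \<Rightarrow> (vec \<Rightarrow> vec) \<Rightarrow> nat \<Rightarrow> mem \<Rightarrow> nat \<Rightarrow> bool"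
where
  "round_time_le k A adv buy n m0 t \<longleftrightarrow>
     (\<forall>(h, m) \<in> set_pmf (play A adv buy n m0 t).
        halts_within k (fst A) (write_vec 1 (adv h) m) \<and>
        (\<forall>m1 \<in> set_pmf (exec (fst A) (write_vec 1 (adv h) m)).
           halts_within k (snd A) (write_vec 3 (buy (adv h)) m1)))"

end

theory Submission
  imports Defs
begin

text \<open>
  The learner is deterministic. Whether the consumer prefers good \<open>j\<close> to good \<open>i\<close> depends on whether
  \<open>v j / v i \<ge> p j / p i\<close>. For each pair the learner keeps a test ratio and predicts as if it were
  \<open>v j / v i\<close>. A wrong prediction shows that the true ratio lies strictly on one side of the test
  ratio, so any search for a fraction by three-way comparisons yields a pairwise learner. Walking down
  the Stern-Brocot tree, with doubling followed by bisection along each branch, takes \<open>O(log (1/\<delta>))\<close>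
  comparisons, hence as many mistakes.

  The pairwise predictions form a tournament, which has a Hamiltonian path. The predicted bundle spends
  the budget greedily along this path. If it differs from the purchase, then the purchased amount
  increases between some two consecutive goods of the path, so a pairwise prediction is refuted. This
  bounds the number of mistakes by \<open>O(n\<^sup>2 log (1/\<delta>))\<close>.
\<close>

text \<open>Bisecting an interval of real ratios could err forever: as long as the test ratio
  differs from the true one, the adversary can choose a price ratio between the two. The search must
  therefore hit the fraction exactly, and without rounding to naturals. Stern-Brocot coordinates
  achieve this: the target is \<open>x * d + y * e\<close> with integers \<open>x, y >= 1\<close>,
  so its size \<open>W\<close> is at least that of \<open>d + e\<close>, and the interval around it
  never becomes narrower than \<open>1 / W^2\<close>. Since \<open>W \<le> 5 / \<delta>\<close>, the
  logarithm of the inverse width (\<open>gain\<close>) is a potential of order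
  \<open>ln (1 / \<delta>)\<close> per pair. Walking one vector at a time would cost order
  \<open>1 / \<delta>\<close> mistakes on a ratio such as \<open>\<delta>\<close>; hence the
  doubling. The size inequalities in \<open>locates\<close> keep strides and sizes balanced, so that
  every refuted guess multiplies \<open>gain\<close> by at least \<open>3 / 2\<close>, whichever way
  it is refuted. As the learner tosses no coins, the outcome of every play is a point mass, and the
  required probability is 1.\<close>

section \<open>Execution of deterministic programs\<close>

definition run :: "nat \<Rightarrow> com \<Rightarrow> mem \<Rightarrow> (mem \<Rightarrow> bool) \<Rightarrow> bool" where
  "run k c m Q \<longleftrightarrow> (\<exists>m'. steps k c m = return_pmf (Skip, m') \<and> Q m')"

text \<open>\<open>steps\<close> appends its last transition, whereas reasoning along a program
  consumes the first one.\<close>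

lemma steps_Suc:
  "steps (Suc k) c m = bind_pmf (step c m) (\<lambda>(c', m'). steps k c' m')"
proof (induction k)
  case 0
  show ?case by (simp add: bind_return_pmf bind_return_pmf' split_def)
next
  case (Suc k)
  have "steps (Suc (Suc k)) c m = bind_pmf (steps (Suc k) c m) (\<lambda>(c', m'). step c' m')"
    by simp
  also have "\<dots> = bind_pmf (step c m) (\<lambda>(c', m'). steps (Suc k) c' m')"
    unfolding Suc by (simp add: bind_assoc_pmf split_def)
  finally show ?case .
qed

lemma steps_halted:
  assumes "steps k c m = return_pmf (Skip, m')" "k \<le> k'"
  shows "steps k' c m = return_pmf (Skip, m')"
  using steps_add_halted[of k c m "k' - k"] assms by (simp add: halts_within_def)

lemma run_mono:
  assumes "run k c m Q" "k \<le> k'" "\<And>m'. Q m' \<Longrightarrow> Q' m'"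
  shows "run k' c m Q'"
  using assms steps_halted unfolding run_def by blast

lemma run_halts: "run k c m Q \<Longrightarrow> halts_within k c m"
  by (auto simp: run_def halts_within_def)

lemma run_exec:
  assumes "run k c m Q"
  obtains m' where "exec c m = return_pmf m'" "Q m'"
  using assms exec_eq[OF run_halts[OF assms]] by (auto simp: run_def)

lemma steps_Seq_Skip: "steps (Suc k) (Seq Skip d) m = steps k d m"
  by (simp only: steps_Suc step.simps if_True simp_thms bind_return_pmf prod.case)

lemma steps_Seq:
  assumes "steps k c m = return_pmf (Skip, m')" "steps l d m' = return_pmf (Skip, m'')"
  shows "steps (Suc (k + l)) (Seq c d) m = return_pmf (Skip, m'')"
  using assms(1)
proof (induction k arbitrary: c m)
  case 0
  then have "c = Skip" "m = m'" by simp_all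
  then show ?case using assms(2) by (simp only: steps_Seq_Skip add_0)
next
  case (Suc k)
  show ?case
  proof (cases "c = Skip")
    case True
    then have "steps (Suc k) c m = return_pmf (Skip, m)" using steps_halted[of 0 c m m "Suc k"] by simp
    then have "m' = m" using Suc.prems by simp
    then have "steps (Suc k + l) d m = return_pmf (Skip, m'')"
      using assms(2) by (metis le_add2 steps_halted)
    then show ?thesis using True by (simp only: steps_Seq_Skip)
  next
    case False
    \<comment> \<open>A mixture that is a point mass has only that point mass as components, so the
      induction hypothesis applies to every successor of the first transition.\<close>
    have 1: "steps k c1 m1 = return_pmf (Skip, m')" if "(c1, m1) \<in> set_pmf (step c m)" for c1 m1
    proof -
      have "set_pmf (steps k c1 m1) \<subseteq> set_pmf (steps (Suc k) c m)"
        unfolding steps_Suc using that by auto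
      then show ?thesis unfolding Suc.prems
        by (simp add: set_pmf_subset_singleton)
    qed
    have "steps (Suc (Suc k + l)) (Seq c d) m
        = bind_pmf (step c m) (\<lambda>(c1, m1). steps (Suc (k + l)) (Seq c1 d) m1)"
      using False
      by (simp only: steps_Suc[of "Suc (k + l)"] step.simps if_False bind_map_pmf split_def fst_conv snd_conv add_Suc)
    also have "\<dots> = bind_pmf (step c m) (\<lambda>_. return_pmf (Skip, m''))"
      using Suc.IH[OF 1] by (intro bind_pmf_cong refl) (simp only: split_def prod.collapse)
    finally show ?thesis by simp
  qed
qed

lemma run_Seq: "run k c m (\<lambda>m'. run l d m' Q) \<Longrightarrow> run (Suc (k + l)) (Seq c d) m Q"
  unfolding run_def using steps_Seq by blast

lemma run_Cond: "run k (if bval b m then c else d) m Q \<Longrightarrow> run (Suc k) (Cond b c d) m Q"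
  by (simp add: run_def steps_Suc bind_return_pmf del: steps.simps)

text \<open>Each iteration costs the \<open>k\<close> steps of the body, one for the test and one to
  discard the finished \<open>Skip\<close> of the \<open>Seq\<close>; the failing test at the end
  accounts for the last 1.\<close>

lemma run_Loop:
  fixes \<mu> :: "mem \<Rightarrow> nat"
  assumes "I m"
    and body: "\<And>m. I m \<Longrightarrow> bval b m \<Longrightarrow> run k c m (\<lambda>m'. I m' \<and> \<mu> m' < \<mu> m)"
    and exit: "\<And>m. I m \<Longrightarrow> \<not> bval b m \<Longrightarrow> Q m"
  shows "run (\<mu> m * (k + 2) + 1) (Loop b c) m Q"
  using assms(1)
proof (induction "\<mu> m" arbitrary: m rule: less_induct)
  case less
  have step: "run (Suc l) (Loop b c) m Q" if "run l (if bval b m then Seq c (Loop b c) else Skip) m Q"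
    for l using that by (simp add: run_def steps_Suc bind_return_pmf del: steps.simps)
  show ?case
  proof (cases "bval b m")
    case False
    have "run 0 Skip m Q" using exit[OF less.prems False] by (simp add: run_def)
    then show ?thesis using step[of 0] False by (auto intro: run_mono)
  next
    case True
    have "run k c m (\<lambda>m'. run ((\<mu> m - 1) * (k + 2) + 1) (Loop b c) m' Q \<and> \<mu> m' < \<mu> m)"
    proof (rule run_mono[OF body[OF less.prems True] order_refl])
      fix m' assume m': "I m' \<and> \<mu> m' < \<mu> m"
      then have "\<mu> m' * (k + 2) + 1 \<le> (\<mu> m - 1) * (k + 2) + 1"
        by (intro add_mono mult_right_mono) auto
      then show "run ((\<mu> m - 1) * (k + 2) + 1) (Loop b c) m' Q \<and> \<mu> m' < \<mu> m"
        using less.hyps[of m'] m' by (auto intro: run_mono)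
    qed
    then have "\<mu> m > 0" and "run k c m (\<lambda>m'. run ((\<mu> m - 1) * (k + 2) + 1) (Loop b c) m' Q)"
      by (auto simp: run_def)
    then have "run (Suc (Suc (k + ((\<mu> m - 1) * (k + 2) + 1)))) (Loop b c) m Q"
      using step True run_Seq by presburger
    moreover have "Suc (Suc (k + ((\<mu> m - 1) * (k + 2) + 1))) = \<mu> m * (k + 2) + 1"
      using \<open>\<mu> m > 0\<close> by (cases "\<mu> m") auto
    ultimately show ?thesis by metis
  qed
qed

section \<open>Straight-line programs as memory transformers with a static time bound\<close>

primrec straight :: "com \<Rightarrow> bool" where
  "straight Skip = True"
| "straight (NSet a i e) = True"
| "straight (RSet a i e) = True"
| "straight (Flip a i) = False"
| "straight (Seq c d) = (straight c \<and> straight d)"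
| "straight (Cond b c d) = (straight c \<and> straight d)"
| "straight (Loop b c) = False"

primrec den :: "com \<Rightarrow> mem \<Rightarrow> mem" where
  "den Skip m = m"
| "den (NSet a i e) m = nstore a (nval i m) (nval e m) m"
| "den (RSet a i e) m = rstore a (nval i m) (rval e m) m"
| "den (Flip a i) m = m"
| "den (Seq c d) m = den d (den c m)"
| "den (Cond b c d) m = (if bval b m then den c m else den d m)"
| "den (Loop b c) m = m"

primrec time :: "com \<Rightarrow> nat" where
  "time Skip = 0"
| "time (NSet a i e) = 1"
| "time (RSet a i e) = 1"
| "time (Flip a i) = 1"
| "time (Seq c d) = Suc (time c + time d)"
| "time (Cond b c d) = Suc (time c + time d)"
| "time (Loop b c) = 0"

lemma run_straight: "straight c \<Longrightarrow> Q (den c m) \<Longrightarrow> run (time c) c m Q"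
proof (induction c arbitrary: m Q)
  case (Seq c d)
  have "run (time c) c m (\<lambda>m'. run (time d) d m' Q)"
    using Seq.prems by (intro Seq.IH(1) Seq.IH(2)) simp_all
  then show ?case by (simp add: run_Seq)
next
  case (Cond b c d)
  have "run (time c + time d) (if bval b m then c else d) m Q"
  proof (cases "bval b m")
    case True
    then have "run (time c) c m Q" using Cond.prems by (intro Cond.IH(1)) auto
    then show ?thesis using True run_mono[of "time c" c m Q "time c + time d" Q] by simp
  next
    case False
    then have "run (time d) d m Q" using Cond.prems by (intro Cond.IH(2)) auto
    then show ?thesis using False run_mono[of "time d" d m Q "time c + time d" Q] by simp
  qed
  then show ?case by (simp add: run_Cond)
qed (simp_all add: run_def bind_return_pmf)

lemma run_straightI: "straight c \<Longrightarrow> time c \<le> k \<Longrightarrow> Q (den c m) \<Longrightarrow> run k c m Q"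
  using run_mono[OF run_straight] by blast

lemma run_straight_Seq:
  assumes "straight c" "time c \<le> k" "run l d (den c m) Q"
  shows "run (Suc (k + l)) (Seq c d) m Q"
  using assms by (intro run_Seq[OF run_straightI])

lemma halts_within_mono: "halts_within k c m \<Longrightarrow> k \<le> k' \<Longrightarrow> halts_within k' c m"
  using steps_add_halted[of k c m "k' - k"] by (simp add: halts_within_def)


section \<open>Searching for a fraction\<close>

text \<open>
  The true direction \<open>(a, b)\<close> lies in the cone spanned by \<open>d = (da, db)\<close> and \<open>e = (ea, eb)\<close>, and the
  test direction is \<open>e + stride * d\<close>. The stride is doubled as long as the target is beyond the test
  direction. Afterwards the target lies between \<open>e\<close> and \<open>e + 2 * stride * d\<close>, which is bisected
  until the stride is 1; then \<open>e\<close> and \<open>e + d\<close> span the new cone, as in Euclid's algorithm.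
\<close>

datatype search = Search (da: real) (db: real) (ea: real) (eb: real) (stride: real) (bisect: bool)

definition narrow :: "search \<Rightarrow> search" where
  "narrow s = (if 1 < stride s then Search (da s) (db s) (ea s) (eb s) (stride s / 2) True
     else Search (ea s) (eb s) (ea s + da s) (eb s + db s) (stride s) False)"

definition shift :: "search \<Rightarrow> search" where
  "shift s = Search (da s) (db s) (ea s + stride s * da s) (eb s + stride s * db s)
     (stride s) (bisect s)"

definition advance :: "bool \<Rightarrow> search \<Rightarrow> search" where
  "advance b s = (if \<not> b then narrow s else if bisect s then narrow (shift s)
     else Search (da s) (db s) (ea (shift s)) (eb (shift s)) (2 * stride s) False)"

definition guess :: "search \<Rightarrow> real \<Rightarrow> real \<Rightarrow> bool" where
  "guess s q r \<longleftrightarrow> (ea s + stride s * da s) * q \<ge> (eb s + stride s * db s) * r"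

definition dsize :: "search \<Rightarrow> real" where "dsize s = 3 * da s + 2 * db s"
definition esize :: "search \<Rightarrow> real" where "esize s = 3 * ea s + 2 * eb s"

text \<open>Integrality of the coordinates \<open>x\<close>, \<open>y\<close> is what makes the
  search finite. While doubling, the size of \<open>e\<close> stays between \<open>stride\<close>
  and \<open>stride + 1\<close> times that of \<open>d\<close>; while bisecting,
  \<open>x < 2 * 2 ^ l * y\<close> places the target before the far end
  \<open>e + 2 * stride * d\<close>. The size inequalities serve only the growth of
  \<open>gain\<close>.\<close>

definition locates :: "search \<Rightarrow> real \<Rightarrow> real \<Rightarrow> bool" where
  "locates s a b \<longleftrightarrow> (\<exists>(x::int) (y::int) (l::nat).
     0 < x \<and> 0 < y \<and> a = x * da s + y * ea s \<and> b = x * db s + y * eb s \<and>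
     stride s = 2 ^ l \<and> 1 \<le> dsize s \<and>
     (if bisect s then x < 2 * (2::int) ^ l * y \<and> 2 * stride s * dsize s \<le> esize s
      else stride s * dsize s \<le> esize s \<and> esize s \<le> (stride s + 1) * dsize s))"

text \<open>The inverse of the width of the interval in which the target is known to lie, where a direction
  \<open>u\<close> is scaled to \<open>3 * fst u + 2 * snd u = 1\<close>. This functional is 1 on both initial vectors.\<close>

definition gain :: "search \<Rightarrow> real" where
  "gain s = (if bisect s then esize s * (esize s + 2 * stride s * dsize s) / (2 * stride s)
     else dsize s * esize s)"

text \<open>The cone spanned by \<open>(-1, 2)\<close> and \<open>(1, -1)\<close> contains the closed quadrant without 0 in its
  interior, so that the ratios 0 and \<open>\<infinity>\<close> are found like any other.\<close>

definition start :: search where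
  "start = Search (- 1) 2 1 (- 1) 1 False"

lemma locatesI:
  fixes x y :: int
  assumes "0 < x" "0 < y" "a = x * da s + y * ea s" "b = x * db s + y * eb s"
    "stride s = 2 ^ l" "1 \<le> dsize s"
    "bisect s \<Longrightarrow> x < 2 * 2 ^ l * y \<and> 2 * stride s * dsize s \<le> esize s"
    "\<not> bisect s \<Longrightarrow> stride s * dsize s \<le> esize s \<and> esize s \<le> (stride s + 1) * dsize s"
  shows "locates s a b"
  using assms unfolding locates_def by (auto split: if_splits)

lemma locates_start:
  fixes a b :: int
  assumes "0 \<le> a" "0 \<le> b" "0 < a + b"
  shows "locates start a b"
  using assms
  \<comment> \<open>The start vectors have determinant -1. Solving \<open>a = - x + y\<close>,
    \<open>b = 2 * x - y\<close> gives these coordinates, positive on the closed quadrant without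
    0.\<close>
  by (intro locatesI[of "a + b" "2 * a + b" _ _ _ 0])
     (auto simp: start_def dsize_def esize_def)

lemma gain_start: "gain start = 1"
  by (simp add: gain_def start_def dsize_def esize_def)

text \<open>The coordinates are at least 1, so the size \<open>W\<close> of the target is at least
  \<open>D + E\<close>. Either form of \<open>gain\<close> is then at most a product of two factors
  bounded by \<open>W\<close>. This caps the number of refuted guesses.\<close>

lemma gain_le:
  assumes "locates s a b"
  shows "gain s \<le> (3 * a + 2 * b)\<^sup>2"
proof -
  obtain x y :: int and l where *: "0 < x" "0 < y" "a = x * da s + y * ea s" "b = x * db s + y * eb s"
    "stride s = 2 ^ l" "1 \<le> dsize s"
    "if bisect s then x < 2 * (2::int) ^ l * y \<and> 2 * stride s * dsize s \<le> esize s
      else stride s * dsize s \<le> esize s \<and> esize s \<le> (stride s + 1) * dsize s"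
    using assms unfolding locates_def by auto
  define D E k W where "D = dsize s" and "E = esize s" and "k = stride s" and "W = 3 * a + 2 * b"
  have k: "k \<ge> 1" using * by (simp add: k_def)
  have D: "D \<ge> 1" using * by (simp add: D_def)
  have "1 * 1 \<le> k * D" using k D by (intro mult_mono) auto
  then have E: "E \<ge> 1" using *(7) by (auto simp: D_def E_def k_def split: if_splits)
  have "W = x * D + y * E"
    using * unfolding W_def D_def E_def dsize_def esize_def by (simp add: algebra_simps)
  moreover have "1 * D \<le> x * D" "1 * E \<le> y * E"
    using * D E by (intro mult_right_mono; simp)+
  ultimately have W: "D + E \<le> W" by simp
  have "gain s \<le> W * W"
  proof (cases "bisect s")
    case True
    have "gain s = E * (E / (2 * k) + D)"
      using True k by (simp add: gain_def D_def E_def k_def field_simps)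
    also have "\<dots> \<le> E * (E + D)"
      using E k by (intro mult_left_mono add_right_mono) (auto simp: divide_le_eq)
    also have "\<dots> \<le> W * W" using W D E by (intro mult_mono) auto
    finally show ?thesis .
  next
    case False
    then have "gain s = D * E" by (simp add: gain_def D_def E_def)
    also have "\<dots> \<le> W * W" using W D E by (intro mult_mono) auto
    finally show ?thesis .
  qed
  then show ?thesis by (simp add: W_def power2_eq_square)
qed

text \<open>The target is known to lie between \<open>e\<close> and \<open>e + stride * d\<close>.
  This interval is stored with half the stride or, at stride 1, as a new cone, but its width is the
  same, hence a single formula for \<open>gain\<close>. The mode is left open because the lemma is
  applied to states of both modes and to a shifted state.\<close>

lemma narrow_locates:
  fixes x y :: int
  assumes "0 < x" "x < 2 ^ l * y" "a = x * da s + y * ea s" "b = x * db s + y * eb s"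
    "stride s = 2 ^ l" "1 \<le> dsize s" "stride s * dsize s \<le> esize s"
  shows "locates (narrow s) a b"
    and "gain (narrow s) = esize s * (esize s + stride s * dsize s) / stride s"
proof -
  have y: "0 < y"
  proof (rule ccontr)
    assume "\<not> 0 < y"
    then have "2 ^ l * y \<le> 0" by (simp add: mult_nonneg_nonpos)
    then show False using assms(1,2) by linarith
  qed
  show "locates (narrow s) a b"
  proof (cases l)
    case 0
    then have "stride s = 1" using assms(5) by simp
    then have n: "narrow s = Search (ea s) (eb s) (ea s + da s) (eb s + db s) 1 False"
      and d: "dsize (narrow s) = esize s" "esize (narrow s) = esize s + dsize s"
      by (simp_all add: narrow_def dsize_def esize_def)
    show ?thesis
    \<comment> \<open>The change of basis
      \<open>x * d + y * e = (y - x) * e + x * (e + d)\<close>.\<close>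
    proof (rule locatesI[of "y - x" x _ _ _ 0])
      show "0 < y - x" using 0 assms(2) by simp
      show "a = (y - x) * da (narrow s) + x * ea (narrow s)"
        "b = (y - x) * db (narrow s) + x * eb (narrow s)"
        using assms(3,4) n by (simp_all add: algebra_simps)
    qed (use assms(1,6,7) n d \<open>stride s = 1\<close> in auto)
  next
    case (Suc l')
    then have k: "stride s > 1" using assms by (simp add: power_gt1 del: power_Suc)
    then have n: "narrow s = Search (da s) (db s) (ea s) (eb s) (stride s / 2) True"
      and d: "dsize (narrow s) = dsize s" "esize (narrow s) = esize s"
      by (simp_all add: narrow_def dsize_def esize_def)
    show ?thesis
      by (rule locatesI[of x y _ _ _ l']) (use assms y Suc n d in auto)
  qed
  have "stride s = 1 \<or> stride s > 1"
    using assms(5) one_le_power[of "2::real" l] by linarith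
  then show "gain (narrow s) = esize s * (esize s + stride s * dsize s) / stride s"
    by (auto simp: gain_def narrow_def dsize_def esize_def field_simps)
qed

text \<open>The functional \<open>f\<close> has opposite signs at the target and at the test
  direction. As the target is \<open>(x - 2 ^ l * y) * d + y * (e + 2 ^ l * d)\<close>, the first
  term must account for the sign, so comparing the signs of \<open>f\<close> at \<open>d\<close> and
  at the target reveals on which side of the test direction the target lies.\<close>

lemma advance_locates:
  fixes s q r a b
  defines "f \<equiv> \<lambda>u v. u * q - v * r"
  assumes loc: "locates s a b"
    and wrong: "guess s q r \<noteq> (a * q \<ge> b * r)"
  defines "s' \<equiv> advance ((da s * q \<ge> db s * r) = (a * q \<ge> b * r)) s"
  shows "locates s' a b" "3 / 2 * gain s \<le> gain s'"
proof -
  obtain x y :: int and l where *: "0 < x" "0 < y" "a = x * da s + y * ea s" "b = x * db s + y * eb s"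
    "stride s = 2 ^ l" "1 \<le> dsize s"
    "if bisect s then x < 2 * (2::int) ^ l * y \<and> 2 * stride s * dsize s \<le> esize s
      else stride s * dsize s \<le> esize s \<and> esize s \<le> (stride s + 1) * dsize s"
    using loc unfolding locates_def by auto
  define D E k where "D = dsize s" and "E = esize s" and "k = stride s"
  have k: "k \<ge> 1" using * by (simp add: k_def)
  have D: "D \<ge> 1" using * by (simp add: D_def)
  have kD: "1 * 1 \<le> k * D" using k D by (intro mult_mono) auto
  have kDE: "k * D \<le> E" using *(7) kD by (auto simp: D_def E_def k_def split: if_splits)
  then have E: "E \<ge> 1" using kD by linarith
  define fd fm fw where "fd = da s * q - db s * r"
    and "fm = (ea s + k * da s) * q - (eb s + k * db s) * r" and "fw = a * q - b * r"
  have eq: "fw = (x - 2 ^ l * y) * fd + y * fm"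
    unfolding fw_def fd_def fm_def k_def *(3-5) by (simp add: algebra_simps)
  have wrong': "(fm \<ge> 0) \<noteq> (fw \<ge> 0)"
    using wrong by (simp add: guess_def fm_def fw_def k_def)
  have s': "s' = advance ((fd \<ge> 0) = (fw \<ge> 0)) s"
    by (simp add: s'_def fd_def fw_def)
  have sgn: "if (fd \<ge> 0) = (fw \<ge> 0) then 2 ^ l * y < x else x < 2 ^ l * y"
  proof -
    define z where "z = x - 2 ^ l * y"
    have eq': "fw = z * fd + y * fm" unfolding eq z_def by simp
    \<comment> \<open>Strict in both cases although signs are taken with \<open>>=\<close>: the
      target is never on the test direction itself, and the new coordinates stay positive.\<close>
    have "if fw \<ge> 0 then 0 < z * fd else z * fd < 0"
    proof (cases "fw \<ge> 0")
      case True
      then have "y * fm < 0" using wrong' *(2) by (simp add: mult_less_0_iff)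
      then show ?thesis using eq' True by simp
    next
      case False
      then have "y * fm \<ge> 0" using wrong' *(2) by simp
      then show ?thesis using eq' False by simp
    qed
    then have "if (fd \<ge> 0) = (fw \<ge> 0) then 0 < z else z < 0"
      by (auto simp: zero_less_mult_iff mult_less_0_iff split: if_splits)
    then show ?thesis by (simp add: z_def split: if_splits)
  qed
  \<comment> \<open>Cutting off the far part: the factor is
    \<open>2 * (E + k * D) / (E + 2 * k * D)\<close> when bisecting, which is \<open>3 / 2\<close>
    at the extreme \<open>E = 2 * k * D\<close>, and \<open>1 + E / (k * D)\<close>, hence at least
    2, when doubling.\<close>
  have gn: "3 / 2 * gain s \<le> E * (E + k * D) / k"
  proof (cases "bisect s")
    case True
    then have "2 * (k * D) \<le> E" using *(7) by (simp add: D_def E_def k_def)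
    then have "3 * (E + 2 * (k * D)) \<le> 4 * (E + k * D)" by (simp add: mult.commute)
    then have "E * (3 * (E + 2 * (k * D))) \<le> E * (4 * (E + k * D))"
      using E by (intro mult_left_mono) auto
    moreover have "3 / 2 * (E * u / (2 * k)) \<le> E * w / k" if "E * (3 * u) \<le> E * (4 * w)" for u w
      using that k by (simp add: field_simps)
    ultimately have "3 / 2 * (E * (E + 2 * (k * D)) / (2 * k)) \<le> E * (E + k * D) / k"
      by blast
    then show ?thesis using True
      by (simp add: gain_def D_def E_def k_def mult.assoc)
  next
    case False
    have "3 * (k * D) \<le> 2 * (E + k * D)" using E kDE by (simp add: mult.commute)
    then have "E * (3 * (k * D)) \<le> E * (2 * (E + k * D))"
      using E by (intro mult_left_mono) auto
    moreover have "3 / 2 * (D * E) \<le> E * w / k" if "E * (3 * (k * D)) \<le> E * (2 * w)" for w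
      using that k by (simp add: field_simps)
    ultimately have "3 / 2 * (D * E) \<le> E * (E + k * D) / k" by blast
    then show ?thesis using False
      by (simp add: gain_def D_def E_def k_def)
  qed
  have "locates s' a b \<and> 3 / 2 * gain s \<le> gain s'"
  proof (cases "(fd \<ge> 0) = (fw \<ge> 0)")
    case False
    then have "s' = narrow s" by (simp add: s' advance_def)
    then show ?thesis
      using narrow_locates[of x l y a s b] sgn False * kDE gn by (simp add: D_def E_def k_def)
  next
    case True
    have E': "E \<le> E + k * D" using kD by simp
    have x': "0 < x - 2 ^ l * y" using True sgn by simp
    have sh: "da (shift s) = da s" "db (shift s) = db s" "stride (shift s) = k" 
      "ea (shift s) = ea s + k * da s" "eb (shift s) = eb s + k * db s"
      "dsize (shift s) = D" "esize (shift s) = E + k * D"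
      by (simp_all add: shift_def D_def E_def k_def dsize_def esize_def algebra_simps)
    show ?thesis
    proof (cases "bisect s")
      case b: True
      then have 2: "s' = narrow (shift s)" using True by (simp add: s' advance_def)
      have "x - 2 ^ l * y < 2 ^ l * y" using *(7) b by (simp add: algebra_simps)
      moreover have "a = real_of_int (x - 2 ^ l * y) * da s + y * (ea s + k * da s)"
        "b = real_of_int (x - 2 ^ l * y) * db s + y * (eb s + k * db s)"
        using *(3-5) by (simp_all add: k_def algebra_simps)
      ultimately have 3: "locates (narrow (shift s)) a b"
        "gain (narrow (shift s)) = (E + k * D) * ((E + k * D) + k * D) / k"
        using narrow_locates[of "x - 2 ^ l * y" l y a "shift s" b] x' sh *(5) D kDE kD
        by (auto simp: k_def)
      \<comment> \<open>The half beyond the test direction is at most as wide as the near half, so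
        \<open>gn\<close> covers it too.\<close>
      have "E * (E + k * D) \<le> (E + k * D) * ((E + k * D) + k * D)"
        using E kD by (intro mult_mono) (auto simp: mult.commute)
      then have "E * (E + k * D) / k \<le> (E + k * D) * ((E + k * D) + k * D) / k"
        using k by (intro divide_right_mono) auto
      then have "3 / 2 * gain s \<le> gain s'" using gn unfolding 2 3(2) by (rule order_trans[rotated])
      then show ?thesis using 2 3(1) by simp
    next
      case b: False
      then have 2: "s' = Search (da s) (db s) (ea s + k * da s) (eb s + k * db s) (2 * k) False"
        using True by (simp add: s' advance_def shift_def k_def)
      have Ek: "E \<le> (k + 1) * D" using *(7) b by (simp add: D_def E_def k_def)
      have ds: "dsize s' = D" "esize s' = E + k * D"
        using 2 by (simp_all add: D_def E_def k_def dsize_def esize_def algebra_simps)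
      have loc': "locates s' a b"
        using x' *(2-5) 2 D kDE Ek ds
        by (intro locatesI[of "x - 2 ^ l * y" y _ _ _ "Suc l"])
           (auto simp: algebra_simps k_def)
      \<comment> \<open>Doubling gains the factor \<open>1 + k * D / E\<close>. Here the upper bound
        on \<open>E\<close> is used: \<open>E \<le> (k + 1) * D \<le> 2 * k * D\<close> makes it at
        least \<open>3 / 2\<close>.\<close>
      have "1 * D \<le> k * D" using k D by (intro mult_right_mono) auto
      then have "3 * E \<le> 2 * (E + k * D)" using Ek by (simp add: algebra_simps)
      then have "D * (3 / 2 * E) \<le> D * (E + k * D)" using D by (intro mult_left_mono) auto
      moreover have "gain s = D * E" "gain s' = D * (E + k * D)"
        using 2 b ds by (simp_all add: gain_def D_def E_def)
      ultimately show ?thesis using loc' by simp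
    qed
  qed
  then show "locates s' a b" "3 / 2 * gain s \<le> gain s'" by auto
qed


section \<open>The purchased bundle\<close>

lemma dot_update:
  assumes "i < n" "length x = n"
  shows "dot n (x[i := c]) y = dot n x y + (c - x ! i) * y ! i"
proof -
  have "dot n (x[i := c]) y = c * y ! i + (\<Sum>l\<in>{..<n} - {i}. x ! l * y ! l)"
    using assms unfolding dot_def by (subst sum.remove[of _ i]) (auto intro!: sum.cong)
  also have "\<dots> = dot n x y + (c - x ! i) * y ! i"
    using assms unfolding dot_def by (subst (2) sum.remove[of _ i]) (auto simp: algebra_simps)
  finally show ?thesis .
qed

lemma cube_nth: "x \<in> cube n \<Longrightarrow> i < n \<Longrightarrow> 0 \<le> x ! i \<and> x ! i \<le> 1"
  by (auto simp: cube_def dest!: nth_mem)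

lemma cube_update: "x \<in> cube n \<Longrightarrow> 0 \<le> c \<Longrightarrow> c \<le> 1 \<Longrightarrow> x[i := c] \<in> cube n"
  using set_update_subset_insert[of x i c] by (auto simp: cube_def)

context
  fixes n v B p x
  assumes v: "\<forall>i<n. 0 \<le> v ! i" and p: "p \<in> cube n" and pur: "purchased n v B p x"
begin

lemma purchased_cube: "x \<in> cube n" and purchased_budget: "dot n x p \<le> B"
  using pur by (auto simp: purchased_def optimal_bundles_def is_arg_max_def)

lemma purchased_max:
  assumes "y \<in> cube n" "dot n y p \<le> B"
  shows "dot n y v \<le> dot n x v"
  using pur assms by (auto simp: purchased_def optimal_bundles_def is_arg_max_def not_less)

lemma purchased_lex:
  assumes y: "y \<in> cube n" "dot n y p \<le> B" "dot n x v \<le> dot n y v"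
    and i: "i < n" "take i y = take i x" "x ! i < y ! i"
  shows False
proof -
  let ?R = "{(a, b). a < (b::real)}"
  have len: "length x = n" "length y = n"
    using purchased_cube y by (auto simp: cube_def)
  have "y \<in> optimal_bundles n v B p"
    using y purchased_max by (fastforce simp: optimal_bundles_def is_arg_max_def)
  then have "y = x \<or> (y, x) \<in> lexord ?R" using pur by (auto simp: purchased_def)
  moreover have "(x, y) \<in> lexord ?R"
    using i len by (auto simp: lexord_take_index_conv)
  moreover have "asym (lexord ?R)" by (intro lexord_asym asymI) auto
  ultimately show False using i by (auto dest: asymD)
qed

text \<open>Even a good of value 0 is raised when affordable: the utility does not drop and the
  bundle becomes lexicographically greater.\<close>

lemma purchased_raise:
  assumes "i < n" "x ! i < c" "c \<le> 1" "dot n x p + (c - x ! i) * p ! i \<le> B"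
  shows False
proof (rule purchased_lex[of "x[i := c]" i])
  have len: "length x = n" using purchased_cube by (simp add: cube_def)
  show "x[i := c] \<in> cube n"
    using assms cube_nth[OF purchased_cube] by (intro cube_update purchased_cube) force+
  show "dot n x v \<le> dot n (x[i := c]) v"
    using assms v len by (simp add: dot_update)
qed (use assms purchased_cube in \<open>auto simp: dot_update cube_def\<close>)

lemma purchased_free:
  assumes "i < n" "p ! i = 0"
  shows "x ! i = 1"
  using purchased_raise[of i 1] cube_nth[OF purchased_cube, of i] purchased_budget assms by force

lemma purchased_exhausts:
  assumes "i < n" "x ! i < 1"
  shows "dot n x p = B"
proof (rule ccontr)
  assume "dot n x p \<noteq> B"
  then have gap: "0 < B - dot n x p" using purchased_budget by simp
  have pi: "0 \<le> p ! i" "p ! i \<le> 1" using cube_nth[OF p] assms by auto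
  \<comment> \<open>As prices are at most 1, \<open>e\<close> units cost at most \<open>e\<close>;
    this avoids dividing by a price that may be 0.\<close>
  define e where "e = min (1 - x ! i) (B - dot n x p)"
  have e: "0 < e" "e \<le> 1 - x ! i" "e \<le> B - dot n x p" using gap assms by (auto simp: e_def)
  have "e * p ! i \<le> e * 1" using e pi by (intro mult_left_mono) auto
  then have "dot n x p + e * p ! i \<le> B" using e by linarith
  then show False using purchased_raise[of i "x ! i + e"] e assms by simp
qed

text \<open>Buying \<open>e * p ! j\<close> more of \<open>i\<close> and \<open>e * p ! i\<close>
  less of \<open>j\<close> leaves the cost unchanged; \<open>e\<close> is the largest amount that
  stays in the cube.\<close>

lemma purchased_transfer:
  assumes i: "i < n" "0 < p ! i" and j: "j < n" "0 < p ! j" and "i \<noteq> j"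
    and xi: "x ! i < 1" and xj: "0 < x ! j"
  obtains e y where "0 < e" "y \<in> cube n" "dot n y p \<le> B"
    "dot n y v = dot n x v + e * (v ! i * p ! j - v ! j * p ! i)"
    "x ! i < y ! i" "i < j \<Longrightarrow> take i y = take i x"
proof -
  have len: "length x = n" using purchased_cube by (simp add: cube_def)
  define e where "e = min ((1 - x ! i) / p ! j) (x ! j / p ! i)"
  define y where "y = x[i := x ! i + e * p ! j, j := x ! j - e * p ! i]"
  have e: "0 < e" using assms by (simp add: e_def)
  have "e \<le> (1 - x ! i) / p ! j" "e \<le> x ! j / p ! i" by (auto simp: e_def)
  then have le: "e * p ! j \<le> 1 - x ! i" "e * p ! i \<le> x ! j"
    using i j by (auto simp: pos_le_divide_eq)
  have x01: "0 \<le> x ! i" "x ! j \<le> 1" using cube_nth[OF purchased_cube] i j by auto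
  have pos: "0 < e * p ! j" "0 < e * p ! i" using e i j by auto
  have "y \<in> cube n" unfolding y_def
    using le pos x01 by (intro cube_update purchased_cube) auto
  moreover have dy: "dot n y w = dot n x w + e * (w ! i * p ! j - w ! j * p ! i)" for w
    using i j len \<open>i \<noteq> j\<close> by (simp add: y_def dot_update algebra_simps)
  moreover have "dot n y p \<le> B" using dy[of p] purchased_budget by simp
  moreover have "x ! i < y ! i" using pos i j len \<open>i \<noteq> j\<close> by (simp add: y_def)
  moreover have "take i y = take i x" if "i < j" using that by (simp add: y_def)
  ultimately show thesis using that e by blast
qed

text \<open>Among equally attractive goods the lexicographic tie-breaking favours the smaller index.\<close>

lemma purchased_order:
  assumes "i < n" "0 < p ! i" "j < n" "0 < p ! j" "i \<noteq> j" "0 < x ! j"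
    and "if i < j then v ! j * p ! i \<le> v ! i * p ! j else v ! j * p ! i < v ! i * p ! j"
  shows "x ! i = 1"
proof (rule ccontr)
  assume "x ! i \<noteq> 1"
  then have "x ! i < 1" using cube_nth[OF purchased_cube, of i] assms by simp
  then obtain e y where y: "0 < e" "y \<in> cube n" "dot n y p \<le> B"
    "dot n y v = dot n x v + e * (v ! i * p ! j - v ! j * p ! i)"
    "x ! i < y ! i" "i < j \<Longrightarrow> take i y = take i x"
    using purchased_transfer[of i j] assms by metis
  show False
  proof (cases "i < j")
    case True
    then have "0 \<le> e * (v ! i * p ! j - v ! j * p ! i)" using y assms by auto
    then show False using purchased_lex[of y i] y assms True by simp
  next
    case False
    then have "0 < e * (v ! i * p ! j - v ! j * p ! i)" using y assms by auto
    then show False using purchased_max[of y] y by simp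
  qed
qed

end

section \<open>Greedy spending along a list of goods\<close>

primrec fill :: "(nat \<Rightarrow> real) \<Rightarrow> real \<Rightarrow> nat list \<Rightarrow> (nat \<Rightarrow> real) \<Rightarrow> nat \<Rightarrow> real" where
  "fill p r [] y = y"
| "fill p r (i # is) y = (if r < p i then fill p 0 is (y(i := r / p i))
     else fill p (r - p i) is (y(i := 1)))"

lemma fill_outside: "i \<notin> set is \<Longrightarrow> fill p r is y i = y i"
  by (induction "is" arbitrary: r y) auto

text \<open>Along the list, \<open>x\<close> consists of ones, at most one other amount, then zeros.
  At the first amount below 1 the later goods cost nothing and the budget is exhausted, so the
  remainder \<open>r\<close> divided by the price is exactly that amount.\<close>

lemma fill_eq:
  assumes "distinct is" "\<And>i. i \<in> set is \<Longrightarrow> 0 < p i \<and> 0 \<le> x i \<and> x i \<le> 1"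
    and "sorted_wrt (\<lambda>i j. 0 < x j \<longrightarrow> x i = 1) is"
    and "(\<Sum>i\<leftarrow>is. x i * p i) \<le> r" "\<And>i. i \<in> set is \<Longrightarrow> x i < 1 \<Longrightarrow> (\<Sum>i\<leftarrow>is. x i * p i) = r"
    and "i \<in> set is"
  shows "fill p r is y i = (x i :: real)"
  using assms
proof (induction "is" arbitrary: r y)
  case (Cons l "is")
  have pl: "0 < p l" "0 \<le> x l" "x l \<le> 1" using Cons.prems(2) by auto
  have rest: "0 \<le> (\<Sum>i\<leftarrow>is. x i * p i)"
    using Cons.prems(2) by (intro sum_list_nonneg) (auto simp: less_imp_le)
  show ?case
  proof (cases "x l = 1")
    case True
    then have nl: "\<not> r < p l" using Cons.prems(4) rest by simp
    show ?thesis
    proof (cases "i = l")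
      case True
      then show ?thesis using nl \<open>x l = 1\<close> Cons.prems(1) by (simp add: fill_outside)
    next
      case False
      have "fill p (r - p l) is (y(l := 1)) i = x i"
      proof (rule Cons.IH)
        show "(\<Sum>i\<leftarrow>is. x i * p i) = r - p l" if "i \<in> set is" "x i < 1" for i
          using Cons.prems(5)[of i] that \<open>x l = 1\<close> by simp
      qed (use Cons.prems False \<open>x l = 1\<close> in auto)
      then show ?thesis using nl by simp
    qed
  next
    case False
    then have l1: "x l < 1" using pl by simp
    have z: "x i = 0" if "i \<in> set is" for i
      using Cons.prems(2)[of i] Cons.prems(3) False that by force
    then have s0: "(\<Sum>i\<leftarrow>is. x i * p i) = 0"
      by (induction "is") auto
    have r: "r = x l * p l" using Cons.prems(5)[of l] l1 s0 by simp
    then have lt: "r < p l" using l1 pl by simp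
    show ?thesis
    proof (cases "i = l")
      case True
      then show ?thesis using lt r pl Cons.prems(1) by (simp add: fill_outside)
    next
      case False
      have "fill p 0 is (y(l := r / p l)) i = x i"
        using Cons.prems False s0 by (intro Cons.IH) auto
      then show ?thesis using lt by simp
    qed
  qed
qed simp


section \<open>The update program\<close>

notation Seq (infixr ";;" 60)

abbreviation var :: "nat \<Rightarrow> nexp" where "var a \<equiv> NGet a (NConst 0)"
abbreviation assign :: "nat \<Rightarrow> nexp \<Rightarrow> com" where "assign a e \<equiv> NSet a (NConst 0) e"
abbreviation const :: "nat \<Rightarrow> rexp" where "const k \<equiv> ROf (NConst k)"

text \<open>
  The natural variables 1, 2, 5 hold \<open>i\<close>, \<open>i * n\<close> and \<open>j\<close>. The path is stored in the natural array 6,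
  its length in variable 4, and variable 3 is a position on it. Real variable 10 is the remaining budget.
\<close>

text \<open>
  The search for the pair of goods \<open>j < i\<close> occupies index \<open>i * n + j\<close> of the real arrays 4 to 9.
  The offsets make the initial memory, which is zero everywhere, represent \<open>start\<close>.
\<close>

definition cell :: "mem \<Rightarrow> nat \<Rightarrow> search" where
  "cell m c = Search (snd m 4 c - 1) (snd m 5 c + 2) (snd m 6 c + 1) (snd m 7 c - 1)
     (snd m 8 c + 1) (0 < snd m 9 c)"

definition da_exp where "da_exp c = RSub (RGet 4 c) (const 1)"
definition db_exp where "db_exp c = RAdd (RGet 5 c) (const 2)"
definition ea_exp where "ea_exp c = RAdd (RGet 6 c) (const 1)"
definition eb_exp where "eb_exp c = RSub (RGet 7 c) (const 1)"
definition stride_exp where "stride_exp c = RAdd (RGet 8 c) (const 1)"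

definition guess_exp :: "nexp \<Rightarrow> rexp \<Rightarrow> rexp \<Rightarrow> bexp" where
  "guess_exp c q r = BNot (RLess
     (RMul (RAdd (ea_exp c) (RMul (stride_exp c) (da_exp c))) q)
     (RMul (RAdd (eb_exp c) (RMul (stride_exp c) (db_exp c))) r))"

definition dir_exp :: "nexp \<Rightarrow> rexp \<Rightarrow> rexp \<Rightarrow> bexp" where
  "dir_exp c q r = BNot (RLess (RMul (da_exp c) q) (RMul (db_exp c) r))"

text \<open>The second branch performs \<open>(d, e) := (e, e + d)\<close> without a temporary:
  \<open>e\<close> is updated first, then the old \<open>e\<close> is recovered as
  \<open>e - d\<close>. The trailing constants undo the offsets of \<open>cell\<close>.\<close>

definition narrow_com :: "nexp \<Rightarrow> com" where
  "narrow_com c = Cond (RLess (const 1) (stride_exp c))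
     (RSet 8 c (RSub (RDiv (stride_exp c) (const 2)) (const 1)) ;; RSet 9 c (const 1))
     (RSet 6 c (RSub (RAdd (ea_exp c) (da_exp c)) (const 1)) ;;
      RSet 4 c (RAdd (RSub (ea_exp c) (da_exp c)) (const 1)) ;;
      RSet 7 c (RAdd (RAdd (eb_exp c) (db_exp c)) (const 1)) ;;
      RSet 5 c (RSub (RSub (eb_exp c) (db_exp c)) (const 2)) ;;
      RSet 9 c (const 0))"

definition advance_com :: "nexp \<Rightarrow> bexp \<Rightarrow> com" where
  "advance_com c b = Cond b
     (RSet 6 c (RAdd (RGet 6 c) (RMul (stride_exp c) (da_exp c))) ;;
      RSet 7 c (RAdd (RGet 7 c) (RMul (stride_exp c) (db_exp c))) ;;
      Cond (RLess (const 0) (RGet 9 c)) (narrow_com c)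
        (RSet 8 c (RSub (RMul (const 2) (stride_exp c)) (const 1))))
     (narrow_com c)"

lemmas exp_defs = da_exp_def db_exp_def ea_exp_def eb_exp_def stride_exp_def

lemma bval_guess: "bval (guess_exp c q r) m \<longleftrightarrow> guess (cell m (nval c m)) (rval q m) (rval r m)"
  by (simp add: guess_exp_def guess_def cell_def exp_defs not_less)

lemma bval_dir: "bval (dir_exp c q r) m \<longleftrightarrow>
    da (cell m (nval c m)) * rval q m \<ge> db (cell m (nval c m)) * rval r m"
  by (simp add: dir_exp_def cell_def exp_defs not_less)

lemma straight_advance: "straight (advance_com c b)"
  by (simp add: advance_com_def narrow_com_def)

lemma time_advance: "time (advance_com c b) = 33"
  by (simp add: advance_com_def narrow_com_def)

lemma nval_cong: "fst m = fst m' \<Longrightarrow> nval e m = nval e m'"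
  by (induction e) auto

lemma nval_rstore: "nval e (rstore a i r m) = nval e m"
  by (rule nval_cong) (simp add: rstore_def)

lemma fst_rstore: "fst (rstore a i r m) = fst m"
  and snd_rstore: "snd (rstore a i r m) = (snd m)(a := (snd m a)(i := r))"
  and snd_nstore: "snd (nstore a k l m) = snd m"
  and fst_nstore: "fst (nstore a k l m) = (fst m)(a := (fst m a)(k := l))"
  by (simp_all add: rstore_def nstore_def)

lemmas store_simps = nval_rstore fst_rstore snd_rstore snd_nstore fst_nstore

lemma den_narrow:
  "fst (den (narrow_com c) m) = fst m"
  "a \<notin> {4..9} \<Longrightarrow> snd (den (narrow_com c) m) a = snd m a"
  "cell (den (narrow_com c) m) l = (if l = nval c m then narrow (cell m l) else cell m l)"
  by (auto simp: narrow_com_def exp_defs store_simps narrow_def cell_def field_simps)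

lemma den_advance:
  "fst (den (advance_com c b) m) = fst m"
  "a \<notin> {4..9} \<Longrightarrow> snd (den (advance_com c b) m) a = snd m a"
  "cell (den (advance_com c b) m) l =
    (if l = nval c m then advance (bval b m) (cell m l) else cell m l)"
proof -
  let ?m = "den (RSet 6 c (RAdd (RGet 6 c) (RMul (stride_exp c) (da_exp c))) ;;
      RSet 7 c (RAdd (RGet 7 c) (RMul (stride_exp c) (db_exp c)))) m"
  have shift: "fst ?m = fst m" "cell ?m l = (if l = nval c m then shift (cell m l) else cell m l)"
    "nval c ?m = nval c m" "snd ?m 9 = snd m 9" "a \<notin> {4..9} \<Longrightarrow> snd ?m a = snd m a" for a l
    by (auto simp: exp_defs store_simps cell_def shift_def)
  have 1: "den (advance_com c b) m = (if bval b m then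
      (if 0 < snd m 9 (nval c m) then den (narrow_com c) ?m
       else rstore 8 (nval c m) (2 * (snd m 8 (nval c m) + 1) - 1) ?m) else den (narrow_com c) m)"
    by (simp add: advance_com_def exp_defs store_simps)
  show "fst (den (advance_com c b) m) = fst m"
    "a \<notin> {4..9} \<Longrightarrow> snd (den (advance_com c b) m) a = snd m a"
    unfolding 1 by (auto simp: den_narrow shift store_simps simp del: den.simps)
  have "0 < snd m 9 (nval c m) \<longleftrightarrow> bisect (cell m (nval c m))" by (simp add: cell_def)
  moreover have "cell (rstore 8 (nval c m) (2 * (snd m 8 (nval c m) + 1) - 1) ?m) l =
     (if l = nval c m then Search (da (cell m l)) (db (cell m l)) (ea (shift (cell m l)))
       (eb (shift (cell m l))) (2 * stride (cell m l)) False else cell m l)"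
    if "\<not> 0 < snd m 9 (nval c m)"
    using that by (auto simp: exp_defs store_simps cell_def shift_def)
  ultimately show "cell (den (advance_com c b) m) l =
    (if l = nval c m then advance (bval b m) (cell m l) else cell m l)"
    unfolding 1 advance_def
    by (cases "l = nval c m") (auto simp: den_narrow(3) shift simp del: den.simps)
qed

text \<open>The purchase stands in for the unknown target: \<open>x i < x j\<close> is the observed
  outcome of \<open>a * p i >= b * p j\<close>. Equal amounts reveal nothing, and a free good is
  bought in full whatever its value.\<close>

definition revise :: "(nat \<Rightarrow> real) \<Rightarrow> (nat \<Rightarrow> real) \<Rightarrow> nat \<Rightarrow> nat \<Rightarrow> search \<Rightarrow> search" where
  "revise p x i j s = (if 0 < p i \<and> 0 < p j \<and> x i \<noteq> x j \<and> guess s (p i) (p j) \<noteq> (x i < x j)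
     then advance ((da s * p i \<ge> db s * p j) = (x i < x j)) s else s)"

definition learn_com :: com where
  "learn_com = (let c = NAdd (var 2) (var 5); pi = RGet 1 (var 1); pj = RGet 1 (var 5);
       xi = RGet 3 (var 1); xj = RGet 3 (var 5) in
     Cond (BAnd (RLess (const 0) pi) (RLess (const 0) pj))
       (Cond (BAnd (RLess xi xj) (BNot (guess_exp c pi pj)))
         (advance_com c (dir_exp c pi pj))
         (Cond (BAnd (RLess xj xi) (guess_exp c pi pj))
           (advance_com c (BNot (dir_exp c pi pj))) Skip))
       Skip)"

lemma straight_learn: "straight learn_com" and time_learn: "time learn_com = 69"
  by (simp_all add: learn_com_def Let_def straight_advance time_advance)

lemma den_learn:
  "fst (den learn_com m) = fst m"
  "a \<notin> {4..9} \<Longrightarrow> snd (den learn_com m) a = snd m a"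
  "cell (den learn_com m) l = (if l = fst m 2 0 + fst m 5 0
     then revise (snd m 1) (snd m 3) (fst m 1 0) (fst m 5 0) (cell m l) else cell m l)"
  by (auto simp: learn_com_def Let_def den_advance bval_guess bval_dir revise_def)

section \<open>One sweep over all pairs of goods\<close>

definition update_step :: com where
  "update_step = Cond (NLess (var 5) (var 1))
     (learn_com ;; assign 5 (NAdd (var 5) (NConst 1)))
     (assign 5 (NConst 0) ;; assign 2 (NAdd (var 2) (var 0)) ;;
      assign 1 (NAdd (var 1) (NConst 1)))"

definition update_com :: com where
  "update_com = assign 1 (NConst 0) ;; assign 2 (NConst 0) ;; assign 5 (NConst 0) ;;
     Loop (NLess (var 1) (var 0)) update_step"

lemma pair_index_inj:
  fixes i j i' j' n :: nat
  assumes "j < n" "j' < n"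
  shows "i * n + j = i' * n + j' \<longleftrightarrow> i = i' \<and> j = j'"
proof
  assume *: "i * n + j = i' * n + j'"
  have "(i * n + j) div n = i" "(i * n + j) mod n = j" "(i' * n + j') div n = i'" "(i' * n + j') mod n = j'"
    using assms by simp_all
  then show "i = i' \<and> j = j'" using * by metis
qed simp

lemma run_update:
  assumes n: "fst m 0 0 = n"
  shows "run (n * (n + 1) * 79 + 10) update_com m (\<lambda>m'.
    fst m' 0 = fst m 0 \<and> snd m' 0 = snd m 0 \<and>
    (\<forall>i<n. \<forall>j<i. cell m' (i * n + j) = revise (snd m 1) (snd m 3) i j (cell m (i * n + j))))"
    (is "run _ _ _ ?Q")
proof -
  define I where "I = (\<lambda>m' :: mem. fst m' 0 = fst m 0 \<and> snd m' 0 = snd m 0 \<and> snd m' 1 = snd m 1 \<and>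
    snd m' 3 = snd m 3 \<and> fst m' 1 0 \<le> n \<and> fst m' 5 0 \<le> fst m' 1 0 \<and> fst m' 2 0 = fst m' 1 0 * n \<and>
    (\<forall>i<n. \<forall>j<i. cell m' (i * n + j) =
      (if i < fst m' 1 0 \<or> i = fst m' 1 0 \<and> j < fst m' 5 0
       then revise (snd m 1) (snd m 3) i j (cell m (i * n + j)) else cell m (i * n + j))))"
  \<comment> \<open>The two nested loops are flattened into one. Each row is allotted
    \<open>n + 1\<close> iterations: row \<open>i\<close> has \<open>i\<close> pairs and one
    iteration that moves to the next row.\<close>
  define \<mu> where "\<mu> = (\<lambda>m' :: mem. (n - fst m' 1 0) * (n + 1) - fst m' 5 0)"
  define m0 where "m0 = den (assign 1 (NConst 0) ;; assign 2 (NConst 0) ;; assign 5 (NConst 0)) m"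
  have m0: "fst m0 0 = fst m 0" "snd m0 = snd m" "fst m0 1 0 = 0" "fst m0 2 0 = 0" "fst m0 5 0 = 0"
    by (simp_all add: m0_def store_simps)
  have I0: "I m0" using m0 by (auto simp: I_def cell_def)
  have body: "run 77 update_step m1 (\<lambda>m'. I m' \<and> \<mu> m' < \<mu> m1)"
    if I: "I m1" and b: "bval (NLess (var 1) (var 0)) m1" for m1
  proof (rule run_straightI)
    define i j where "i = fst m1 1 0" and "j = fst m1 5 0"
    have ij: "i < n" "j \<le> i" "fst m1 2 0 = i * n" "fst m1 0 0 = n"
      using I b n by (auto simp: I_def i_def j_def)
    have gap: "(n - i) * (n + 1) = (n - Suc i) * (n + 1) + (n + 1)"
    proof -
      have "n - i = Suc (n - Suc i)" using ij by simp
      then show ?thesis by (simp only: mult_Suc add.commute)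
    qed
    have \<mu>1: "\<mu> m1 = (n - i) * (n + 1) - j" by (simp add: \<mu>_def i_def j_def)
    show "I (den update_step m1) \<and> \<mu> (den update_step m1) < \<mu> m1"
    proof (cases "j < i")
      case True
      define m2 where "m2 = den learn_com m1"
      have m2: "fst m2 = fst m1" "\<And>a. a \<notin> {4..9} \<Longrightarrow> snd m2 a = snd m1 a"
        "\<And>l. cell m2 l = (if l = i * n + j then revise (snd m1 1) (snd m1 3) i j (cell m1 l) else cell m1 l)"
        using ij by (auto simp: m2_def den_learn i_def j_def)
      have d: "den update_step m1 = nstore 5 0 (Suc j) m2"
        using True m2(1) by (simp add: update_step_def m2_def i_def j_def del: den_learn)
      have c: "cell (nstore 5 0 (Suc j) m2) l = cell m2 l" for l
        by (simp add: cell_def store_simps)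
      have "I (den update_step m1)"
        using I True ij unfolding I_def d c
        by (auto simp: store_simps m2 pair_index_inj i_def j_def less_Suc_eq)
      moreover have "\<mu> (den update_step m1) < \<mu> m1"
      proof -
        have "\<mu> (den update_step m1) = (n - i) * (n + 1) - Suc j"
          by (simp add: \<mu>_def d store_simps m2 i_def)
        then show ?thesis using \<mu>1 gap ij by linarith
      qed
      ultimately show ?thesis by simp
    next
      case False
      then have d: "den update_step m1 = nstore 1 0 (Suc i) (nstore 2 0 (i * n + n) (nstore 5 0 0 m1))"
        using ij by (simp add: update_step_def store_simps i_def j_def)
      have c: "cell (den update_step m1) l = cell m1 l" for l
        by (simp add: cell_def store_simps d)
      have "I (den update_step m1)"
        using I False ij unfolding I_def c
        by (auto simp: d store_simps i_def j_def less_Suc_eq)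
      moreover have "\<mu> (den update_step m1) < \<mu> m1"
      proof -
        have "\<mu> (den update_step m1) = (n - Suc i) * (n + 1)"
          by (simp add: \<mu>_def d store_simps)
        then show ?thesis using \<mu>1 gap ij by linarith
      qed
      ultimately show ?thesis by simp
    qed
  qed (simp_all add: update_step_def straight_learn time_learn)
  have "run (\<mu> m0 * (77 + 2) + 1) (Loop (NLess (var 1) (var 0)) update_step) m0 ?Q"
  proof (rule run_Loop[of I])
    show "?Q m'" if "I m'" "\<not> bval (NLess (var 1) (var 0)) m'" for m'
      using that n by (auto simp: I_def)
  qed (use I0 body in auto)
  then have "run (Suc (1 + Suc (1 + Suc (1 + (\<mu> m0 * (77 + 2) + 1))))) update_com m ?Q"
    unfolding update_com_def
    by (intro run_straight_Seq) (simp_all add: m0_def)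
  moreover have "\<mu> m0 = n * (n + 1)"
    unfolding \<mu>_def m0 by simp
  ultimately show ?thesis
    by (auto intro: run_mono)
qed


section \<open>The prediction program\<close>

text \<open>A good is predicted to be preferred to another. One search per unordered pair answers
  both directions, so exactly one of two distinct goods beats the other; the relation may well be
  cyclic.\<close>

definition beats :: "(nat \<Rightarrow> real) \<Rightarrow> (nat \<Rightarrow> search) \<Rightarrow> nat \<Rightarrow> nat \<Rightarrow> nat \<Rightarrow> bool" where
  "beats p S n i j \<longleftrightarrow> (if i < j then guess (S (j * n + i)) (p j) (p i)
     else \<not> guess (S (i * n + j)) (p i) (p j))"

definition shift_loop :: com where
  "shift_loop = (let pred = NGet 6 (NSub (var 3) (NConst 1)) in
     Loop (BAnd (NLess (NConst 0) (var 3))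
         (BNot (guess_exp (NAdd (var 2) pred) (RGet 1 (var 1)) (RGet 1 pred))))
       (NSet 6 (var 3) pred ;; assign 3 (NSub (var 3) (NConst 1))))"

definition insert_step :: com where
  "insert_step = Cond (RLess (const 0) (RGet 1 (var 1)))
       (assign 3 (var 4) ;; shift_loop ;; NSet 6 (var 3) (var 1) ;;
        assign 4 (NAdd (var 4) (NConst 1)))
       (RSet 2 (var 1) (const 1)) ;;
     assign 2 (NAdd (var 2) (var 0)) ;; assign 1 (NAdd (var 1) (NConst 1))"

definition fill_step :: com where
  "fill_step = (let cur = NGet 6 (var 3); rest = RGet 10 (NConst 0) in
     Cond (RLess rest (RGet 1 cur))
       (RSet 2 cur (RDiv rest (RGet 1 cur)) ;; RSet 10 (NConst 0) (const 0))
       (RSet 2 cur (const 1) ;; RSet 10 (NConst 0) (RSub rest (RGet 1 cur))) ;;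
     assign 3 (NAdd (var 3) (NConst 1)))"

definition predict_com :: com where
  "predict_com = assign 1 (NConst 0) ;; assign 2 (NConst 0) ;; assign 4 (NConst 0) ;;
     Loop (NLess (var 1) (var 0)) insert_step ;;
     assign 3 (NConst 0) ;; RSet 10 (NConst 0) (RGet 0 (NConst 2)) ;;
     Loop (NLess (var 3) (var 4)) fill_step"

definition frame :: "mem \<Rightarrow> mem \<Rightarrow> bool" where
  "frame m m' \<longleftrightarrow> fst m' 0 = fst m 0 \<and> (\<forall>a. a \<notin> {2, 10} \<longrightarrow> snd m' a = snd m a)"

lemma frame_cell: "frame m m' \<Longrightarrow> cell m' = cell m"
  by (auto simp: frame_def cell_def fun_eq_iff)

text \<open>The inner loop of insertion sort, run on a tournament as in the usual proof of Redei's
  theorem. Good \<open>i\<close> moves left past goods that it beats: the last one passed becomes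
  its successor, and the one where it stops beats it by totality. No other adjacent pair is
  created.\<close>

lemma run_shift_loop:
  assumes len: "fst m 3 0 = length xs" "length xs \<le> n"
    and row: "fst m 2 0 = fst m 1 0 * n"
    and xs: "\<And>t. t < length xs \<Longrightarrow> fst m 6 t = xs ! t" "\<And>l. l \<in> set xs \<Longrightarrow> l < fst m 1 0"
  defines "i \<equiv> fst m 1 0" and "R \<equiv> beats (snd m 1) (cell m) n"
  shows "run (n * 5 + 1) shift_loop m (\<lambda>m'. snd m' = snd m \<and>
    (\<forall>a. a \<notin> {3, 6} \<longrightarrow> fst m' a = fst m a) \<and>
    (let q = fst m' 3 0 in q \<le> length xs \<and>
      (\<forall>t<q. fst m' 6 t = xs ! t) \<and>
      (\<forall>t. q \<le> t \<longrightarrow> t < length xs \<longrightarrow> fst m' 6 (Suc t) = xs ! t) \<and>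
      (0 < q \<longrightarrow> R (xs ! (q - 1)) i) \<and> (q < length xs \<longrightarrow> R i (xs ! q))))"
    (is "run _ _ _ ?Q")
proof -
  define I where "I = (\<lambda>m' :: mem. snd m' = snd m \<and>
    (\<forall>a. a \<notin> {3, 6} \<longrightarrow> fst m' a = fst m a) \<and>
    (let q = fst m' 3 0 in q \<le> length xs \<and>
      (\<forall>t<q. fst m' 6 t = xs ! t) \<and>
      (\<forall>t. q \<le> t \<longrightarrow> t < length xs \<longrightarrow> fst m' 6 (Suc t) = xs ! t) \<and>
      (q < length xs \<longrightarrow> R i (xs ! q))))"
  define b where "b = (let pred = NGet 6 (NSub (var 3) (NConst 1)) in
     BAnd (NLess (NConst 0) (var 3))
         (BNot (guess_exp (NAdd (var 2) pred) (RGet 1 (var 1)) (RGet 1 pred))))"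
  define c where "c = NSet 6 (var 3) (NGet 6 (NSub (var 3) (NConst 1))) ;;
     assign 3 (NSub (var 3) (NConst 1))"
  have b: "bval b m' \<longleftrightarrow> 0 < fst m' 3 0 \<and> R i (xs ! (fst m' 3 0 - 1))"
    if "I m'" for m'
  proof (cases "fst m' 3 0")
    case (Suc q)
    then have q: "fst m' 6 q = xs ! q" "q < length xs" "cell m' = cell m" "snd m' = snd m"
      "fst m' 1 = fst m 1" "fst m' 2 = fst m 2"
      using that by (auto simp: I_def Let_def cell_def)
    moreover have "xs ! q < i" using q xs(2) by (simp add: i_def)
    ultimately show ?thesis using Suc row
      by (simp add: b_def Let_def bval_guess R_def beats_def i_def)
  qed (simp add: b_def Let_def)
  have not_R: "R l i" if "\<not> R i l" "l < i" for l
    using that by (simp add: R_def beats_def)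
  have "run (fst m 3 0 * (3 + 2) + 1) (Loop b c) m ?Q"
  proof (rule run_Loop[where I = I and \<mu> = "\<lambda>m'. fst m' 3 0"])
    show "I m" using len xs by (simp add: I_def)
    show "run 3 c m' (\<lambda>m''. I m'' \<and> fst m'' 3 0 < fst m' 3 0)" if I: "I m'" and bm: "bval b m'" for m'
    proof (rule run_straightI)
      obtain q where q: "fst m' 3 0 = Suc q" "R i (xs ! q)" "q < length xs"
        using bm I b[OF I] by (cases "fst m' 3 0") (auto simp: I_def Let_def)
      have d: "den c m' = nstore 3 0 q (nstore 6 (Suc q) (xs ! q) m')"
        using q I by (simp add: c_def store_simps I_def Let_def)
      have "I (den c m')"
        using I q by (auto simp: I_def Let_def d store_simps le_Suc_eq)
      then show "I (den c m') \<and> fst (den c m') 3 0 < fst m' 3 0"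
        by (simp add: d store_simps q)
    qed (simp_all add: c_def)
    show "?Q m'" if I: "I m'" and "\<not> bval b m'" for m'
    proof -
      have "0 < fst m' 3 0 \<longrightarrow> R (xs ! (fst m' 3 0 - 1)) i"
      proof
        assume "0 < fst m' 3 0"
        moreover have "fst m' 3 0 \<le> length xs" using I by (simp add: I_def Let_def)
        ultimately show "R (xs ! (fst m' 3 0 - 1)) i"
          using b[OF I] that xs(2) by (intro not_R) (auto simp: i_def)
      qed
      then show ?thesis using I by (simp add: I_def Let_def)
    qed
  qed
  moreover have "shift_loop = Loop b c" by (simp add: shift_loop_def b_def c_def Let_def)
  ultimately show ?thesis using len by (auto elim!: run_mono)
qed

lemma insert_nth:
  assumes "q \<le> length xs" "\<And>t. t < q \<Longrightarrow> f t = xs ! t" "f q = i"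
    "\<And>t. q \<le> t \<Longrightarrow> t < length xs \<Longrightarrow> f (Suc t) = xs ! t"
    and t: "t < Suc (length xs)"
  shows "f t = (take q xs @ i # drop q xs) ! t"
proof -
  consider "t < q" | "t = q" | t' where "t = Suc t'" "q \<le> t'" "t' < length xs"
    using t by (cases t) fastforce+
  then show ?thesis
  proof cases
    case 3
    then have "t - q = Suc (t' - q)" by simp
    then show ?thesis using assms 3 by (simp add: nth_append)
  qed (use assms in \<open>auto simp: nth_append\<close>)
qed

lemma successively_insert:
  assumes "successively R xs" "q \<le> length xs"
    "0 < q \<Longrightarrow> R (xs ! (q - 1)) i" "q < length xs \<Longrightarrow> R i (xs ! q)"
  shows "successively R (take q xs @ i # drop q xs)"
proof -
  have "successively R (take q xs @ drop q xs)" using assms(1) by simp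
  then have "successively R (take q xs)" "successively R (drop q xs)"
    by (simp_all only: successively_append_iff)
  moreover have "R (last (take q xs)) i" if "take q xs \<noteq> []"
    using that assms(2,3) by (auto simp: last_conv_nth min_def)
  moreover have "R i (hd (drop q xs))" if "drop q xs \<noteq> []"
    using that assms(4) by (simp add: hd_drop_conv_nth)
  ultimately show ?thesis
    by (auto simp: successively_append_iff successively_Cons)
qed

definition path_inv :: "mem \<Rightarrow> nat \<Rightarrow> nat \<Rightarrow> nat list \<Rightarrow> mem \<Rightarrow> bool" where
  "path_inv m n i xs m' \<longleftrightarrow> frame m m' \<and> fst m' 4 0 = length xs \<and>
     (\<forall>t<length xs. fst m' 6 t = xs ! t) \<and> distinct xs \<and>
     set xs = {l. l < i \<and> 0 < snd m 1 l} \<and> successively (beats (snd m 1) (cell m) n) xs \<and>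
     (\<forall>l<i. \<not> 0 < snd m 1 l \<longrightarrow> snd m' 2 l = 1)"

lemma path_inv_length: "path_inv m n i xs m' \<Longrightarrow> length xs \<le> i"
  using card_mono[of "{..<i}" "set xs"] by (auto simp: path_inv_def distinct_card[symmetric])

lemma run_insert_step:
  assumes n: "fst m 0 0 = n" and P: "path_inv m n i xs m1"
    and i: "fst m1 1 0 = i" "i < n" and row: "fst m1 2 0 = i * n"
  shows "run (n * 5 + 15) insert_step m1 (\<lambda>m2. (\<exists>xs. path_inv m n (Suc i) xs m2) \<and>
     fst m2 1 0 = Suc i \<and> fst m2 2 0 = Suc i * n)"
proof -
  define cond where "cond = Cond (RLess (const 0) (RGet 1 (var 1)))
       (assign 3 (var 4) ;; shift_loop ;; NSet 6 (var 3) (var 1) ;;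
        assign 4 (NAdd (var 4) (NConst 1)))
       (RSet 2 (var 1) (const 1))"
  define step where "step = assign 2 (NAdd (var 2) (var 0)) ;; assign 1 (NAdd (var 1) (NConst 1))"
  let ?R = "beats (snd m 1) (cell m) n"
  have fr: "frame m m1" and p: "snd m1 1 = snd m 1" and cl: "cell m1 = cell m"
    using P frame_cell by (auto simp: path_inv_def frame_def)
  have "run (n * 5 + 10) cond m1 (\<lambda>m2. (\<exists>xs. path_inv m n (Suc i) xs m2) \<and>
     fst m2 1 0 = i \<and> fst m2 2 0 = i * n)" (is "run _ _ _ ?Q")
  proof (cases "0 < snd m 1 i")
    case False
    let ?m2 = "rstore 2 i 1 m1"
    have "path_inv m n (Suc i) xs ?m2"
      using P False by (auto simp: path_inv_def frame_def store_simps less_Suc_eq)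
    then have "run 1 (RSet 2 (var 1) (const 1)) m1 ?Q"
      using i row by (intro run_straightI) (auto simp: fst_rstore)
    then have "run 2 cond m1 ?Q"
      unfolding cond_def numeral_2_eq_2 using False i p by (intro run_Cond) simp
    then show ?thesis by (auto elim: run_mono)
  next
    case True
    let ?m2 = "nstore 3 0 (length xs) m1"
    have len: "length xs \<le> n" using path_inv_length[OF P] i by simp
    have c2: "cell ?m2 = cell m" using cl by (auto simp: cell_def store_simps fun_eq_iff)
    have "run (n * 5 + 1) shift_loop ?m2 (\<lambda>m'. snd m' = snd ?m2 \<and>
      (\<forall>a. a \<notin> {3, 6} \<longrightarrow> fst m' a = fst ?m2 a) \<and>
      (let q = fst m' 3 0 in q \<le> length xs \<and>
        (\<forall>t<q. fst m' 6 t = xs ! t) \<and>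
        (\<forall>t. q \<le> t \<longrightarrow> t < length xs \<longrightarrow> fst m' 6 (Suc t) = xs ! t) \<and>
        (0 < q \<longrightarrow> ?R (xs ! (q - 1)) i) \<and> (q < length xs \<longrightarrow> ?R i (xs ! q))))"
      (is "run _ _ _ ?S")
      using run_shift_loop[of ?m2 xs n] P len i row c2 p
      by (auto simp: store_simps path_inv_def)
    then have "run (n * 5 + 1) shift_loop ?m2 (\<lambda>m'. run 3 (NSet 6 (var 3) (var 1) ;;
        assign 4 (NAdd (var 4) (NConst 1))) m' ?Q)"
    proof (rule run_mono[OF _ order_refl])
      fix m3 assume S: "?S m3"
      define q where "q = fst m3 3 0"
      have q: "q \<le> length xs" "\<And>t. t < q \<Longrightarrow> fst m3 6 t = xs ! t"
        "\<And>t. q \<le> t \<Longrightarrow> t < length xs \<Longrightarrow> fst m3 6 (Suc t) = xs ! t"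
        "0 < q \<Longrightarrow> ?R (xs ! (q - 1)) i" "q < length xs \<Longrightarrow> ?R i (xs ! q)"
        using S by (simp_all add: q_def Let_def)
      have m3: "snd m3 = snd m1" "\<And>a. a \<notin> {3, 6} \<Longrightarrow> fst m3 a = fst m1 a"
        using S by (simp_all add: store_simps)
      let ?ys = "take q xs @ i # drop q xs"
      let ?m4 = "nstore 4 0 (Suc (length xs)) (nstore 6 q i m3)"
      have "set ?ys = insert i (set xs)" by (metis append_take_drop_id set_append list.simps(15) Un_insert_right)
      moreover have "distinct ?ys"
        using P in_set_takeD[of i q xs] in_set_dropD[of i q xs]
          set_take_disj_set_drop_if_distinct[of xs q q] by (auto simp: path_inv_def)
      moreover have "successively ?R ?ys"
        using P q by (intro successively_insert) (auto simp: path_inv_def)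
      moreover have "fst ?m4 6 t = ?ys ! t" if "t < Suc (length xs)" for t
        using q that by (intro insert_nth) (auto simp: store_simps)
      ultimately have ys: "path_inv m n (Suc i) ?ys ?m4"
        using P q True m3 unfolding path_inv_def
        by (auto simp: store_simps frame_def less_Suc_eq)
      have "den (NSet 6 (var 3) (var 1) ;; assign 4 (NAdd (var 4) (NConst 1))) m3 = ?m4"
        using i m3 P by (simp add: store_simps q_def path_inv_def)
      moreover have "?Q ?m4"
        using ys i row m3 by (intro conjI exI[of _ ?ys]) (simp_all add: store_simps)
      ultimately show "run 3 (NSet 6 (var 3) (var 1) ;; assign 4 (NAdd (var 4) (NConst 1))) m3 ?Q"
        by (intro run_straightI) (simp_all only:, simp_all)
    qed
    then have "run (Suc (n * 5 + 1 + 3)) (shift_loop ;; NSet 6 (var 3) (var 1) ;;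
        assign 4 (NAdd (var 4) (NConst 1))) ?m2 ?Q"
      by (rule run_Seq)
    moreover have "fst m1 4 0 = length xs" using P by (simp add: path_inv_def)
    ultimately have "run (Suc (1 + Suc (n * 5 + 1 + 3))) (assign 3 (var 4) ;; shift_loop ;;
        NSet 6 (var 3) (var 1) ;; assign 4 (NAdd (var 4) (NConst 1))) m1 ?Q"
      by (intro run_straight_Seq[of "assign 3 (var 4)"]) simp_all
    then have "run (Suc (Suc (1 + Suc (n * 5 + 1 + 3)))) cond m1 ?Q"
      unfolding cond_def using True i p by (intro run_Cond) simp
    then show ?thesis by (auto elim: run_mono)
  qed
  then have "run (n * 5 + 10) cond m1 (\<lambda>m2. run 3 step m2 (\<lambda>m2.
     (\<exists>xs. path_inv m n (Suc i) xs m2) \<and> fst m2 1 0 = Suc i \<and> fst m2 2 0 = Suc i * n))"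
  proof (rule run_mono[OF _ order_refl])
    fix m2 assume m2: "?Q m2"
    then obtain ys where ys: "path_inv m n (Suc i) ys m2" by blast
    then have "fst m2 0 0 = n" using n by (simp add: path_inv_def frame_def)
    moreover have "path_inv m n (Suc i) ys (den step m2)"
      using ys by (simp add: path_inv_def frame_def step_def store_simps)
    ultimately show "run 3 step m2 (\<lambda>m2.
       (\<exists>xs. path_inv m n (Suc i) xs m2) \<and> fst m2 1 0 = Suc i \<and> fst m2 2 0 = Suc i * n)"
      using m2 by (intro run_straightI) (auto simp: step_def store_simps)
  qed
  then have "run (Suc (n * 5 + 10 + 3)) insert_step m1 (\<lambda>m2.
     (\<exists>xs. path_inv m n (Suc i) xs m2) \<and> fst m2 1 0 = Suc i \<and> fst m2 2 0 = Suc i * n)"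
    unfolding insert_step_def cond_def step_def by (rule run_Seq)
  then show ?thesis by (auto elim!: run_mono)
qed

lemma run_predict:
  assumes n: "fst m 0 0 = n"
  shows "run (n * (5 * n + 30) + 20) predict_com m (\<lambda>m'. frame m m' \<and>
    (\<exists>xs y. distinct xs \<and> set xs = {l. l < n \<and> 0 < snd m 1 l} \<and>
      successively (beats (snd m 1) (cell m) n) xs \<and>
      (\<forall>l<n. \<not> 0 < snd m 1 l \<longrightarrow> y l = 1) \<and> snd m' 2 = fill (snd m 1) (snd m 0 2) xs y))"
    (is "run _ _ _ ?Q")
proof -
  let ?b1 = "NLess (var 1) (var 0)" and ?b2 = "NLess (var 3) (var 4)"
  let ?m0 = "nstore 4 0 0 (nstore 2 0 0 (nstore 1 0 0 m))"
  let ?J = "\<lambda>m'. fst m' 1 0 \<le> n \<and> fst m' 2 0 = fst m' 1 0 * n \<and>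
    (\<exists>xs. path_inv m n (fst m' 1 0) xs m')"
  have "run ((n - fst ?m0 1 0) * (n * 5 + 15 + 2) + 1) (Loop ?b1 insert_step) ?m0
     (\<lambda>m1. \<exists>xs. path_inv m n n xs m1)"
  proof (rule run_Loop[where I = ?J and \<mu> = "\<lambda>m'. n - fst m' 1 0"])
    have "path_inv m n 0 [] ?m0" by (simp add: path_inv_def frame_def store_simps)
    then show "?J ?m0" by (auto simp: store_simps)
    show "\<exists>xs. path_inv m n n xs m1" if "?J m1" "\<not> bval ?b1 m1" for m1
      using that n by (auto simp: path_inv_def frame_def)
    show "run (n * 5 + 15) insert_step m1 (\<lambda>m2. ?J m2 \<and> n - fst m2 1 0 < n - fst m1 1 0)"
      if J: "?J m1" and b: "bval ?b1 m1" for m1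
    proof -
      obtain xs where xs: "path_inv m n (fst m1 1 0) xs m1" using J by blast
      then have "fst m1 1 0 < n" using b n by (simp add: path_inv_def frame_def)
      then show ?thesis
        using run_insert_step[OF n xs refl] J by (auto elim!: run_mono)
    qed
  qed
  then have "run (n * (17 + n * 5) + 1) (Loop ?b1 insert_step) ?m0
     (\<lambda>m1. \<exists>xs. path_inv m n n xs m1)"
    by (simp add: store_simps)
  then have "run (n * (17 + n * 5) + 1) (Loop ?b1 insert_step) ?m0 (\<lambda>m1.
     run (n * 12 + 5) (assign 3 (NConst 0) ;; RSet 10 (NConst 0) (RGet 0 (NConst 2)) ;;
       Loop ?b2 fill_step) m1 ?Q)"
  proof (rule run_mono[OF _ order_refl])
    fix m1 assume "\<exists>xs. path_inv m n n xs m1"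
    then obtain xs where xs: "path_inv m n n xs m1" by blast
    let ?m2 = "rstore 10 0 (snd m 0 2) (nstore 3 0 0 m1)"
    \<comment> \<open>\<open>fill\<close> is tail recursive, so the loop invariant says that
      \<open>fill\<close> applied to the current state still yields \<open>F\<close>.\<close>
    define F where "F = fill (snd m 1) (snd m 0 2) xs (snd m1 2)"
    let ?I = "\<lambda>m'. frame m m' \<and> fst m' 4 0 = length xs \<and> (\<forall>t<length xs. fst m' 6 t = xs ! t) \<and>
      fst m' 3 0 \<le> length xs \<and>
      fill (snd m 1) (snd m' 10 0) (drop (fst m' 3 0) xs) (snd m' 2) = F"
    have "run ((length xs - fst ?m2 3 0) * (9 + 2) + 1) (Loop ?b2 fill_step) ?m2 ?Q"
    proof (rule run_Loop[where I = ?I and \<mu> = "\<lambda>m'. length xs - fst m' 3 0"])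
      show "?I ?m2" using xs by (auto simp: path_inv_def frame_def store_simps F_def)
      show "?Q m'" if "?I m'" "\<not> bval ?b2 m'" for m'
        using that xs
        by (intro conjI exI[of _ xs] exI[of _ "snd m1 2"]) (auto simp: path_inv_def F_def)
      show "run 9 fill_step m3 (\<lambda>m4. ?I m4 \<and> length xs - fst m4 3 0 < length xs - fst m3 3 0)"
        if I: "?I m3" and b: "bval ?b2 m3" for m3
      proof (rule run_straightI)
        define t where "t = fst m3 3 0"
        have t: "t < length xs" "fst m3 6 t = xs ! t" "snd m3 1 = snd m 1"
          using I b by (auto simp: t_def frame_def)
        have F: "fill (snd m 1) (snd m3 10 0) (xs ! t # drop (Suc t) xs) (snd m3 2) = F"
          using I t Cons_nth_drop_Suc[OF t(1)] by (simp add: t_def)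
        have d: "den fill_step m3 = nstore 3 0 (Suc t) (if snd m3 10 0 < snd m 1 (xs ! t)
          then rstore 10 0 0 (rstore 2 (xs ! t) (snd m3 10 0 / snd m 1 (xs ! t)) m3)
          else rstore 10 0 (snd m3 10 0 - snd m 1 (xs ! t)) (rstore 2 (xs ! t) 1 m3))"
          using t by (simp add: fill_step_def Let_def store_simps t_def[symmetric])
        have 1: "?I (den fill_step m3)"
          using I t F unfolding d by (auto simp: store_simps frame_def)
        have 2: "fst (den fill_step m3) 3 0 = Suc t" by (simp add: d store_simps)
        have 3: "length xs - fst (den fill_step m3) 3 0 < length xs - fst m3 3 0"
          unfolding 2 t_def[symmetric] using t(1) by simp
        show "?I (den fill_step m3) \<and>
            length xs - fst (den fill_step m3) 3 0 < length xs - fst m3 3 0"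
          by (rule conjI[OF 1 3])
      qed (simp_all add: fill_step_def Let_def)
    qed
    then have "run (Suc (1 + Suc (1 + (length xs * 11 + 1)))) (assign 3 (NConst 0) ;;
       RSet 10 (NConst 0) (RGet 0 (NConst 2)) ;; Loop ?b2 fill_step) m1 ?Q"
      using xs by (intro run_straight_Seq) (simp_all add: store_simps path_inv_def frame_def)
    then show "run (n * 12 + 5) (assign 3 (NConst 0) ;; RSet 10 (NConst 0) (RGet 0 (NConst 2)) ;;
       Loop ?b2 fill_step) m1 ?Q"
      using path_inv_length[OF xs] by (auto elim!: run_mono)
  qed
  then have loops: "run (Suc (n * (17 + n * 5) + 1 + (n * 12 + 5))) (Loop ?b1 insert_step ;;
     assign 3 (NConst 0) ;; RSet 10 (NConst 0) (RGet 0 (NConst 2)) ;; Loop ?b2 fill_step) ?m0 ?Q"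
    by (rule run_Seq)
  have "run (Suc (1 + Suc (1 + Suc (1 + Suc (n * (17 + n * 5) + 1 + (n * 12 + 5))))))
      predict_com m ?Q"
    unfolding predict_com_def
    by (rule run_straight_Seq, simp, simp, rule run_straight_Seq, simp, simp,
        rule run_straight_Seq, simp, simp, use loops in simp)
  then show ?thesis by (rule run_mono) (simp_all add: algebra_simps)
qed


section \<open>The mistake bound\<close>

text \<open>If both values are 0, then the good with the smaller index comes first at all prices, so the
  ratio counts as infinite.\<close>

definition target_a :: "real \<Rightarrow> vec \<Rightarrow> nat \<Rightarrow> nat \<Rightarrow> real" where
  "target_a \<delta> v i j = (if v ! i = 0 \<and> v ! j = 0 then 1 else v ! j / \<delta>)"

definition target_b :: "real \<Rightarrow> vec \<Rightarrow> nat \<Rightarrow> nat \<Rightarrow> real" where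
  "target_b \<delta> v i j = v ! i / \<delta>"

lemma valuation_nth:
  assumes "v \<in> valuations n \<delta>" "0 < \<delta>" "i < n"
  obtains k :: nat where "v ! i = real k * \<delta>" "real k \<le> 1 / \<delta>"
proof -
  have "v ! i \<in> {real k * \<delta> | k. real k * \<delta> \<le> 1}"
    using assms by (auto simp: valuations_def dest!: nth_mem)
  then show thesis using that assms(2) by (auto simp: pos_le_divide_eq)
qed

lemma valuations_nonneg:
  assumes "v \<in> valuations n \<delta>" "0 < \<delta>"
  shows "\<forall>i<n. 0 \<le> v ! i"
proof (intro allI impI)
  fix i assume "i < n"
  then obtain k :: nat where "v ! i = real k * \<delta>" using valuation_nth[OF assms] by metis
  then show "0 \<le> v ! i" using assms(2) by simp
qed

lemma target_locates_start:
  assumes "v \<in> valuations n \<delta>" "0 < \<delta>" "i < n" "j < n"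
  shows "locates start (target_a \<delta> v i j) (target_b \<delta> v i j)"
proof -
  obtain k l :: nat where k: "v ! i = real k * \<delta>" and l: "v ! j = real l * \<delta>"
    using valuation_nth assms by metis
  show ?thesis
  proof (cases "k = 0 \<and> l = 0")
    case True
    then show ?thesis using locates_start[of 1 0] k l
      by (simp add: target_a_def target_b_def)
  next
    case False
    then show ?thesis using locates_start[of "int l" "int k"] k l assms(2)
      by (auto simp: target_a_def target_b_def)
  qed
qed

lemma target_bound:
  assumes "v \<in> valuations n \<delta>" "0 < \<delta>" "\<delta> < 1" "i < n" "j < n"
  shows "(3 * target_a \<delta> v i j + 2 * target_b \<delta> v i j)\<^sup>2 \<le> (5 / \<delta>)\<^sup>2"
proof -
  obtain k l :: nat where k: "v ! i = real k * \<delta>" "real k \<le> 1 / \<delta>"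
    and l: "v ! j = real l * \<delta>" "real l \<le> 1 / \<delta>"
    using valuation_nth assms by metis
  have "0 \<le> target_a \<delta> v i j" "target_a \<delta> v i j \<le> 1 / \<delta>"
    using k l assms(2,3) by (auto simp: target_a_def)
  moreover have "0 \<le> target_b \<delta> v i j" "target_b \<delta> v i j \<le> 1 / \<delta>"
    using k assms(2) by (auto simp: target_b_def)
  ultimately show ?thesis by (intro power_mono) auto
qed

text \<open>If any of the less attractive good is bought, the more attractive one is bought in full;
  so unequal amounts reveal the preference. At equal attractiveness the smaller index
  \<open>j\<close> wins, which matches the \<open>>=\<close> in \<open>guess\<close>.\<close>

lemma target_order:
  assumes v: "v \<in> valuations n \<delta>" "0 < \<delta>" and p: "p \<in> cube n" "purchased n v B p x"
    and ij: "i < n" "j < i" "0 < p ! i" "0 < p ! j" "x ! i \<noteq> x ! j"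
  shows "x ! i < x ! j \<longleftrightarrow> target_a \<delta> v i j * p ! i \<ge> target_b \<delta> v i j * p ! j"
proof -
  note v0 = valuations_nonneg[OF v]
  have x: "0 \<le> x ! l" "x ! l \<le> 1" if "l < n" for l
    using cube_nth[OF purchased_cube[OF v0 p]] that by auto
  have "target_a \<delta> v i j * p ! i \<ge> target_b \<delta> v i j * p ! j \<longleftrightarrow> v ! i * p ! j \<le> v ! j * p ! i"
    using v(2) ij by (auto simp: target_a_def target_b_def divide_le_cancel)
  moreover have "x ! j = 1" if "v ! i * p ! j \<le> v ! j * p ! i" "0 < x ! i"
    using purchased_order[OF v0 p, of j i] that ij by simp
  moreover have "x ! i = 1" if "\<not> v ! i * p ! j \<le> v ! j * p ! i" "0 < x ! j"
    using purchased_order[OF v0 p, of i j] that ij by simp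
  moreover have "0 \<le> x ! i" "x ! i \<le> 1" "0 \<le> x ! j" "x ! j \<le> 1"
    using x ij by auto
  ultimately show ?thesis using ij(5)
    by (cases "v ! i * p ! j \<le> v ! j * p ! i"; linarith)
qed

text \<open>A Hamiltonian path of the predicted tournament suffices, transitivity is not needed: a path
  along which the purchase is non-increasing already determines the purchase.\<close>

lemma fill_path:
  assumes v: "\<forall>i<n. 0 \<le> v ! i" and p: "p \<in> cube n" "purchased n v B p x"
    and P: "\<And>i. i < n \<Longrightarrow> P i = p ! i"
    and xs: "distinct xs" "set xs = {l. l < n \<and> 0 < P l}" "successively (beats P S n) xs"
    and y: "\<And>l. l < n \<Longrightarrow> \<not> 0 < P l \<Longrightarrow> y l = 1"
    and consistent: "\<And>i j. i < n \<Longrightarrow> j < i \<Longrightarrow> 0 < P i \<Longrightarrow> 0 < P j \<Longrightarrow> x ! i \<noteq> x ! j \<Longrightarrow>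
      guess (S (i * n + j)) (P i) (P j) \<longleftrightarrow> x ! i < x ! j"
    and l: "l < n"
  shows "fill P B xs y l = x ! l"
proof -
  have cube: "0 \<le> x ! l" "x ! l \<le> 1" if "l < n" for l
    using cube_nth[OF purchased_cube[OF v p]] that by auto
  have p0: "0 \<le> p ! l" if "l < n" for l using cube_nth[OF p(1)] that by auto
  show ?thesis
  proof (cases "0 < P l")
    case False
    then have "x ! l = 1" using purchased_free[OF v p l] P[OF l] p0[OF l] by simp
    then show ?thesis using False y[OF l] xs(2) by (simp add: fill_outside)
  next
    case True
    have "x ! j \<le> x ! i" if "i \<in> set xs" "j \<in> set xs" "beats P S n i j" for i j
    proof (cases i j rule: linorder_cases)
      case less
      then show ?thesis using that xs(2) consistent[of j i] by (force simp: beats_def)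
    next
      case greater
      then show ?thesis using that xs(2) consistent[of i j] by (force simp: beats_def)
    qed simp
    then have "successively (\<lambda>i j. x ! j \<le> x ! i) xs"
      using xs(3) by (rule successively_mono[rotated])
    then have decr: "sorted_wrt (\<lambda>i j. x ! j \<le> x ! i) xs"
      by (subst (asm) successively_conv_sorted_wrt) (auto intro: transpI)
    have full: "x ! i = 1" if "i \<in> set xs" "j \<in> set xs" "i \<noteq> j" "x ! j \<le> x ! i" "0 < x ! j" for i j
    proof -
      have ij: "i < n" "j < n" "0 < p ! i" "0 < p ! j" using that xs(2) P by auto
      have xi: "0 < x ! i" using that by linarith
      \<comment> \<open>Whichever good the consumer really prefers is bought in full. If it is
        \<open>j\<close>, then \<open>x ! j \<le> x ! i\<close> lifts \<open>x ! i\<close> to 1 as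
        well, so the path need not follow the true preferences.\<close>
      have "x ! i = 1 \<or> x ! j = 1"
      proof (cases "if i < j then v ! j * p ! i \<le> v ! i * p ! j else v ! j * p ! i < v ! i * p ! j")
        case True
        then show ?thesis using purchased_order[OF v p, of i j] ij that by simp
      next
        case False
        then have "if j < i then v ! i * p ! j \<le> v ! j * p ! i else v ! i * p ! j < v ! j * p ! i"
          using \<open>i \<noteq> j\<close> by (auto split: if_splits)
        then show ?thesis using purchased_order[OF v p, of j i] ij that xi by simp
      qed
      then show ?thesis using cube[OF ij(1)] that by auto
    qed
    have sorted: "sorted_wrt (\<lambda>i j. 0 < x ! j \<longrightarrow> x ! i = 1) xs"
      unfolding sorted_wrt_iff_nth_less
    proof (intro allI impI)
      fix s t assume st: "s < t" "t < length xs" "0 < x ! (xs ! t)"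
      then have "xs ! s \<noteq> xs ! t" using xs(1) by (simp add: nth_eq_iff_index_eq)
      moreover have "x ! (xs ! t) \<le> x ! (xs ! s)"
        using decr st by (simp add: sorted_wrt_iff_nth_less)
      ultimately show "x ! (xs ! s) = 1" using st by (intro full[of _ "xs ! t"]) auto
    qed
    have "(\<Sum>i\<leftarrow>xs. x ! i * P i) = (\<Sum>i\<in>set xs. x ! i * P i)"
      using xs(1) by (rule sum_list_distinct_conv_sum_set)
    also have "\<dots> = (\<Sum>i\<in>set xs. x ! i * p ! i)"
      using xs(2) P by (intro sum.cong) auto
    also have "\<dots> = (\<Sum>i<n. x ! i * p ! i)"
    proof (rule sum.mono_neutral_left)
      show "\<forall>i\<in>{..<n} - set xs. x ! i * p ! i = 0"
      proof
        fix i assume "i \<in> {..<n} - set xs"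
        then have "i < n" "\<not> 0 < P i" using xs(2) by auto
        then have "p ! i = 0" using p0[of i] P[of i] by linarith
        then show "x ! i * p ! i = 0" by simp
      qed
    qed (use xs(2) in auto)
    finally have spent: "(\<Sum>i\<leftarrow>xs. x ! i * P i) = dot n x p" by (simp add: dot_def)
    show ?thesis
    proof (rule fill_eq[OF xs(1) _ sorted])
      show "0 < P i \<and> 0 \<le> x ! i \<and> x ! i \<le> 1" if "i \<in> set xs" for i
        using that xs(2) cube by simp
      show "(\<Sum>i\<leftarrow>xs. x ! i * P i) = B" if "i \<in> set xs" "x ! i < 1" for i
      proof -
        have "i < n" using that(1) xs(2) by simp
        then have "dot n x p = B" using that(2) by (rule purchased_exhausts[OF v p])
        then show ?thesis using spent by simp
      qed
    qed (use spent purchased_budget[OF v p] l True xs(2) in simp_all)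
  qed
qed

section \<open>The potential over the rounds\<close>

lemma mistakes_snoc:
  "mistakes (h @ [(p, xhat, x)]) = mistakes h + (if xhat = x then 0 else 1)"
proof -
  have "{t. t < length (h @ [(p, xhat, x)]) \<and> (case (h @ [(p, xhat, x)]) ! t of (p, xhat, x) \<Rightarrow> xhat \<noteq> x)}
    = {t. t < length h \<and> (case h ! t of (p, xhat, x) \<Rightarrow> xhat \<noteq> x)} \<union>
      (if xhat = x then {} else {length h})"
    by (auto simp: nth_append less_Suc_eq)
  then show ?thesis by (simp add: mistakes_def)
qed

text \<open>Every mistake multiplies some gain by at least \<open>3 / 2\<close>.\<close>

definition learned :: "nat \<Rightarrow> real \<Rightarrow> real \<Rightarrow> vec \<Rightarrow> history \<Rightarrow> mem \<Rightarrow> bool" where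
  "learned n \<delta> B v h m \<longleftrightarrow> fst m 0 0 = n \<and> snd m 0 2 = B \<and>
     (\<forall>i<n. \<forall>j<i. locates (cell m (i * n + j)) (target_a \<delta> v i j) (target_b \<delta> v i j) \<and>
        1 \<le> gain (cell m (i * n + j))) \<and>
     real (mistakes h) * ln (3 / 2) \<le> (\<Sum>i<n. \<Sum>j<i. ln (gain (cell m (i * n + j))))"

lemma learned_initial:
  assumes "v \<in> valuations n \<delta>" "0 < \<delta>"
  shows "learned n \<delta> B v [] (initial_mem n \<delta> \<beta> B)"
proof -
  have "cell (initial_mem n \<delta> \<beta> B) l = start" for l
    by (simp add: cell_def start_def initial_mem_def nstore_def rstore_def)
  moreover have "fst (initial_mem n \<delta> \<beta> B) 0 0 = n" "snd (initial_mem n \<delta> \<beta> B) 0 2 = B"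
    by (simp_all add: initial_mem_def nstore_def rstore_def)
  ultimately show ?thesis
    using target_locates_start[OF assms]
    by (auto simp: learned_def gain_start mistakes_def)
qed

lemma learned_mistakes:
  assumes v: "v \<in> valuations n \<delta>" and \<delta>: "0 < \<delta>" "\<delta> < 1" "1 / \<delta> \<in> \<nat>" and L: "learned n \<delta> B v h m"
  shows "real (mistakes h) \<le> 24 * (real n ^ 2 * ln (1 / \<delta>))"
proof -
  obtain N :: nat where N: "1 / \<delta> = real N" using \<delta>(3) by (auto elim: Nats_cases)
  have "1 < 1 / \<delta>" using \<delta> by simp
  then have N2: "2 \<le> 1 / \<delta>" using N by simp
  \<comment> \<open>As \<open>1 / \<delta>\<close> is an integer above 1, it is at least 2, and
    \<open>5 \<le> 2 ^ 3\<close> absorbs the constant 5 into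
    \<open>ln (1 / \<delta>)\<close>.\<close>
  have "ln (5 :: real) \<le> ln (2 ^ 3)" by simp
  also have "\<dots> = 3 * ln (2 :: real)" by (simp only: ln_realpow)
  also have "\<dots> \<le> 3 * ln (1 / \<delta>)" using N2 \<delta> by (intro mult_left_mono ln_mono) auto
  finally have "ln (5 / \<delta>) \<le> 4 * ln (1 / \<delta>)" using \<delta> by (simp add: ln_div)
  then have ln5: "ln ((5 / \<delta>)\<^sup>2) \<le> 8 * ln (1 / \<delta>)" using \<delta> by (simp add: ln_realpow)
  have nonneg: "0 \<le> 8 * ln (1 / \<delta>)" using N2 by simp
  \<comment> \<open>This factor 3 and the 8 of \<open>ln5\<close> make up the constant 24.\<close>
  have "(1 :: real) / 3 \<le> ln (3 / 2)" using ln_le_minus_one[of "2 / 3 :: real"] by (simp add: ln_div)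
  then have "real (mistakes h) * (1 / 3) \<le> real (mistakes h) * ln (3 / 2)"
    by (intro mult_left_mono) auto
  also have "\<dots> \<le> (\<Sum>i<n. \<Sum>j<i. ln (gain (cell m (i * n + j))))"
    using L by (simp add: learned_def)
  also have "\<dots> \<le> (\<Sum>i<n. \<Sum>j<i. 8 * ln (1 / \<delta>))"
  proof (intro sum_mono)
    fix i j assume ij: "i \<in> {..<n}" "j \<in> {..<i}"
    then have g: "1 \<le> gain (cell m (i * n + j))"
      and l: "locates (cell m (i * n + j)) (target_a \<delta> v i j) (target_b \<delta> v i j)"
      using L by (auto simp: learned_def)
    have "gain (cell m (i * n + j)) \<le> (5 / \<delta>)\<^sup>2"
      using gain_le[OF l] target_bound[OF v \<delta>(1,2), of i j] ij by simp
    then have "ln (gain (cell m (i * n + j))) \<le> ln ((5 / \<delta>)\<^sup>2)" using g by (intro ln_mono) auto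
    then show "ln (gain (cell m (i * n + j))) \<le> 8 * ln (1 / \<delta>)" using ln5 by linarith
  qed
  also have "\<dots> \<le> (\<Sum>i<n. \<Sum>j<n. 8 * ln (1 / \<delta>))"
    using nonneg by (intro sum_mono sum_mono2) auto
  also have "\<dots> = 8 * (real n ^ 2 * ln (1 / \<delta>))" by (simp add: power2_eq_square)
  finally show ?thesis by simp
qed


lemma revise_locates:
  assumes "locates s a b" "1 \<le> gain s"
    and "0 < p i \<Longrightarrow> 0 < p j \<Longrightarrow> x i \<noteq> x j \<Longrightarrow> x i < x j \<longleftrightarrow> a * p i \<ge> b * p j"
  shows "locates (revise p x i j s) a b" "gain s \<le> gain (revise p x i j s)"
    "0 < p i \<Longrightarrow> 0 < p j \<Longrightarrow> x i \<noteq> x j \<Longrightarrow> guess s (p i) (p j) \<noteq> (x i < x j) \<Longrightarrow>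
      3 / 2 * gain s \<le> gain (revise p x i j s)"
proof -
  let ?c = "0 < p i \<and> 0 < p j \<and> x i \<noteq> x j \<and> guess s (p i) (p j) \<noteq> (x i < x j)"
  have *: "locates (revise p x i j s) a b \<and> 3 / 2 * gain s \<le> gain (revise p x i j s)" if ?c
    using advance_locates[OF assms(1), of "p i" "p j"] assms(3) that by (auto simp: revise_def)
  show "locates (revise p x i j s) a b" "gain s \<le> gain (revise p x i j s)"
    using * assms(1,2) by (cases ?c; force simp: revise_def)+
  show "3 / 2 * gain s \<le> gain (revise p x i j s)"
    if "0 < p i" "0 < p j" "x i \<noteq> x j" "guess s (p i) (p j) \<noteq> (x i < x j)"
    using * that by blast
qed

lemma sum_mono_gap:
  fixes f g :: "'a \<Rightarrow> real"
  assumes "finite A" "a \<in> A" "f a + c \<le> g a" "\<And>x. x \<in> A \<Longrightarrow> f x \<le> g x"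
  shows "sum f A + c \<le> sum g A"
proof -
  have "sum f (A - {a}) \<le> sum g (A - {a})" using assms(4) by (intro sum_mono) auto
  then show ?thesis using assms(3) by (simp add: sum.remove[OF assms(1,2)])
qed

lemma learned_round:
  assumes v: "v \<in> valuations n \<delta>" "0 < \<delta>" and p: "p \<in> cube n" "purchased n v B p x"
    and L: "learned n \<delta> B v h m"
  obtains m1 m2 where "exec predict_com (write_vec 1 p m) = return_pmf m1"
    "exec update_com (write_vec 3 x m1) = return_pmf m2"
    "halts_within (100 * (n + 1)\<^sup>2) predict_com (write_vec 1 p m)"
    "halts_within (100 * (n + 1)\<^sup>2) update_com (write_vec 3 x m1)"
    "learned n \<delta> B v (h @ [(p, read_vec n 2 m1, x)]) m2"
proof -
  note v0 = valuations_nonneg[OF v]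
  have len: "length p = n" "length x = n"
    using p(1) purchased_cube[OF v0 p] by (auto simp: cube_def)
  define mp where "mp = write_vec 1 p m"
  have mp: "fst mp 0 0 = n" "snd mp 0 2 = B" "cell mp = cell m" "\<And>i. i < n \<Longrightarrow> snd mp 1 i = p ! i"
    using L len by (simp_all add: mp_def write_vec_def learned_def cell_def fun_eq_iff)
  note predict = run_predict[OF mp(1)]
  obtain m1 xs y where m1: "exec predict_com mp = return_pmf m1" "frame mp m1"
    and xs: "distinct xs" "set xs = {l. l < n \<and> 0 < snd mp 1 l}"
      "successively (beats (snd mp 1) (cell mp) n) xs"
      "\<And>l. l < n \<Longrightarrow> \<not> 0 < snd mp 1 l \<Longrightarrow> y l = 1"
      "snd m1 2 = fill (snd mp 1) B xs y"
    by (rule run_exec[OF predict]) (use mp(2) in blast)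
  define mx where "mx = write_vec 3 x m1"
  have mx: "fst mx 0 0 = n" "snd mx 0 2 = B" "cell mx = cell m" "\<And>i. i < n \<Longrightarrow> snd mx 1 i = p ! i"
    "\<And>i. i < n \<Longrightarrow> snd mx 3 i = x ! i"
    using mp m1(2) len frame_cell[OF m1(2)]
    by (simp_all add: mx_def write_vec_def frame_def cell_def fun_eq_iff)
  note update = run_update[OF mx(1)]
  obtain m2 where m2: "exec update_com mx = return_pmf m2" "fst m2 0 = fst mx 0" "snd m2 0 = snd mx 0"
    "\<And>i j. i < n \<Longrightarrow> j < i \<Longrightarrow>
      cell m2 (i * n + j) = revise (snd mx 1) (snd mx 3) i j (cell m (i * n + j))"
    by (rule run_exec[OF update]) (use mx(3) in auto)
  define S S' where "S = (\<lambda>i j. cell m (i * n + j))" and "S' = (\<lambda>i j. cell m2 (i * n + j))"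
  have loc: "locates (S i j) (target_a \<delta> v i j) (target_b \<delta> v i j)" "1 \<le> gain (S i j)"
    if "j < i" "i < n" for i j using L that by (auto simp: learned_def S_def)
  have order: "snd mx 3 i < snd mx 3 j \<longleftrightarrow>
      target_a \<delta> v i j * snd mx 1 i \<ge> target_b \<delta> v i j * snd mx 1 j"
    if "j < i" "i < n" "0 < snd mx 1 i" "0 < snd mx 1 j" "snd mx 3 i \<noteq> snd mx 3 j" for i j
    using target_order[OF v p, of i j] that mx(4,5)[of i] mx(4,5)[of j] by simp
  have loc': "locates (S' i j) (target_a \<delta> v i j) (target_b \<delta> v i j)"
    and grow: "gain (S i j) \<le> gain (S' i j)"
    if "j < i" "i < n" for i j
    using revise_locates(1,2)[OF loc[OF that], of "snd mx 1" i j "snd mx 3"] order[OF that] m2(4) that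
    by (auto simp: S_def S'_def)
  have grow_strict: "3 / 2 * gain (S i j) \<le> gain (S' i j)"
    if "j < i" "i < n" "0 < p ! i" "0 < p ! j" "x ! i \<noteq> x ! j"
      "guess (S i j) (p ! i) (p ! j) \<noteq> (x ! i < x ! j)" for i j
    using revise_locates(3)[OF loc[OF that(1,2)], of "snd mx 1" i j "snd mx 3"] order[of j i] m2(4) mx that
    by (auto simp: S_def S'_def)
  have ln_grow: "ln (gain (S i j)) \<le> ln (gain (S' i j))" if "j < i" "i < n" for i j
    using loc(2)[OF that] grow[OF that] by simp
  let ?pot = "\<lambda>S :: nat \<Rightarrow> nat \<Rightarrow> search. \<Sum>i<n. \<Sum>j<i. ln (gain (S i j))"
  \<comment> \<open>If no pair is refuted, \<open>fill_path\<close> makes the prediction exact. So a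
    mistake comes with a refuted pair, whose term rises by at least \<open>ln (3 / 2)\<close>, while
    no other term falls.\<close>
  have pot: "?pot S + (if read_vec n 2 m1 = x then 0 else ln (3 / 2)) \<le> ?pot S'"
  proof (cases "\<exists>i j. j < i \<and> i < n \<and> 0 < p ! i \<and> 0 < p ! j \<and> x ! i \<noteq> x ! j \<and>
      guess (S i j) (p ! i) (p ! j) \<noteq> (x ! i < x ! j)")
    case False
    then have agree: "guess (S i j) (p ! i) (p ! j) \<longleftrightarrow> x ! i < x ! j"
      if "j < i" "i < n" "0 < p ! i" "0 < p ! j" "x ! i \<noteq> x ! j" for i j
      using that by blast
    have consistent: "guess (cell mp (i * n + j)) (snd mp 1 i) (snd mp 1 j) \<longleftrightarrow> x ! i < x ! j"
      if "i < n" "j < i" "0 < snd mp 1 i" "0 < snd mp 1 j" "x ! i \<noteq> x ! j" for i j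
    proof -
      have "snd mp 1 i = p ! i" "snd mp 1 j = p ! j" using that mp(4) by auto
      then show ?thesis using agree[of j i] that by (simp add: S_def mp(3))
    qed
    have "snd m1 2 l = x ! l" if "l < n" for l
    proof -
      note path = fill_path[where n = n and v = v and p = p and B = B and x = x and P = "snd mp 1"
          and S = "cell mp" and xs = xs and y = y and l = l]
      show ?thesis
        unfolding xs(5) by (rule path) (fact v0 p mp(4) xs(1-4) consistent that)+
    qed
    then have "read_vec n 2 m1 = x"
      using len by (intro nth_equalityI) (simp_all add: read_vec_def)
    then show ?thesis using ln_grow by (auto intro!: sum_mono)
  next
    case True
    then obtain i j where ij: "j < i" "i < n" "3 / 2 * gain (S i j) \<le> gain (S' i j)"
      using grow_strict by blast
    have "ln (3 / 2 * gain (S i j)) \<le> ln (gain (S' i j))"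
      using ij loc(2)[OF ij(1,2)] by (intro ln_mono) auto
    then have "ln (gain (S i j)) + ln (3 / 2) \<le> ln (gain (S' i j))"
      using loc(2)[OF ij(1,2)] ln_mult[of "3 / 2" "gain (S i j)"] by simp
    then have row: "(\<Sum>j<i. ln (gain (S i j))) + ln (3 / 2) \<le> (\<Sum>j<i. ln (gain (S' i j)))"
      using ij ln_grow by (auto intro: sum_mono_gap[where a = j])
    have "?pot S + ln (3 / 2) \<le> ?pot S'"
    proof (rule sum_mono_gap[where a = i])
      show "(\<Sum>j<i. ln (gain (S i j))) \<le> (\<Sum>j<i. ln (gain (S' i j)))" if "i \<in> {..<n}" for i
        using that ln_grow by (intro sum_mono) auto
    qed (use ij row in simp_all)
    moreover have "(if read_vec n 2 m1 = x then 0 else ln (3 / 2)) \<le> ln (3 / 2 :: real)" by simp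
    ultimately show ?thesis by linarith
  qed
  have learned: "learned n \<delta> B v (h @ [(p, read_vec n 2 m1, x)]) m2"
    unfolding learned_def
  proof (intro conjI allI impI)
    have "real (mistakes h) * ln (3 / 2) \<le> ?pot S" using L by (simp add: learned_def S_def)
    moreover have "real (mistakes (h @ [(p, read_vec n 2 m1, x)])) * ln (3 / 2) =
        real (mistakes h) * ln (3 / 2) + (if read_vec n 2 m1 = x then 0 else ln (3 / 2))"
      by (simp add: mistakes_snoc distrib_right)
    ultimately have "real (mistakes (h @ [(p, read_vec n 2 m1, x)])) * ln (3 / 2) \<le> ?pot S'"
      using pot by linarith
    then show "real (mistakes (h @ [(p, read_vec n 2 m1, x)])) * ln (3 / 2)
        \<le> (\<Sum>i<n. \<Sum>j<i. ln (gain (cell m2 (i * n + j))))" by (simp add: S'_def)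
    show "1 \<le> gain (cell m2 (i * n + j))" if "i < n" "j < i" for i j
      using grow[OF that(2,1)] loc(2)[OF that(2,1)] by (simp add: S'_def)
  qed (use m2 mx loc' in \<open>auto simp: S'_def\<close>)
  have time: "n * (5 * n + 30) + 20 \<le> 100 * (n + 1)\<^sup>2" "n * (n + 1) * 79 + 10 \<le> 100 * (n + 1)\<^sup>2"
    by (simp_all add: power2_eq_square algebra_simps)
  have halts: "halts_within (100 * (n + 1)\<^sup>2) predict_com mp"
    "halts_within (100 * (n + 1)\<^sup>2) update_com mx"
    by (rule halts_within_mono[OF run_halts[OF predict] time(1)],
        rule halts_within_mono[OF run_halts[OF update] time(2)])
  show thesis
    by (rule that[OF m1(1)[unfolded mp_def] m2(1)[unfolded mx_def]
          halts(1)[unfolded mp_def] halts(2)[unfolded mx_def] learned])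
qed

lemma play_learned:
  assumes v: "v \<in> valuations n \<delta>" "0 < \<delta>"
    and buy: "\<forall>p \<in> cube n. purchased n v B p (buy p)" and adv: "\<forall>h. adv h \<in> cube n"
  shows "\<exists>h m. play (predict_com, update_com) adv buy n (initial_mem n \<delta> \<beta> B) t = return_pmf (h, m) \<and>
    learned n \<delta> B v h m"
proof (induction t)
  case 0
  show ?case using learned_initial[OF v] by simp
next
  case (Suc t)
  then obtain h m where h: "play (predict_com, update_com) adv buy n (initial_mem n \<delta> \<beta> B) t = return_pmf (h, m)"
    "learned n \<delta> B v h m" by blast
  have p: "adv h \<in> cube n" "purchased n v B (adv h) (buy (adv h))" using buy adv by auto
  from learned_round[OF v p h(2)] obtain m1 m2 where
    "exec predict_com (write_vec 1 (adv h) m) = return_pmf m1"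
    "exec update_com (write_vec 3 (buy (adv h)) m1) = return_pmf m2"
    "learned n \<delta> B v (h @ [(adv h, read_vec n 2 m1, buy (adv h))]) m2" by metis
  then show ?case using h(1) by (simp add: bind_return_pmf Let_def)
qed

theorem theorem4:
  shows "\<exists>(A :: learner) (q :: real poly) (C :: real).
    \<forall>(n :: nat) (\<delta> :: real) (\<beta> :: real) (B :: real) (v :: vec)
      (buy :: vec \<Rightarrow> vec) (adv :: history \<Rightarrow> vec) (T :: nat).
      1 \<le> n \<longrightarrow> 0 < \<delta> \<longrightarrow> \<delta> < 1 \<longrightarrow> 1 / \<delta> \<in> \<nat> \<longrightarrow> 0 < \<beta> \<longrightarrow> \<beta> < 1 \<longrightarrow> 0 \<le> B \<longrightarrow>
      v \<in> valuations n \<delta> \<longrightarrow>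
      (\<forall>p \<in> cube n. purchased n v B p (buy p)) \<longrightarrow>
      (\<forall>h. adv h \<in> cube n) \<longrightarrow>
      (\<forall>t<T. round_time_le (nat \<lfloor>poly q (real n + ln (1 / \<delta>) + ln (1 / \<beta>))\<rfloor>)
               A adv buy n (initial_mem n \<delta> \<beta> B) t) \<and>
      measure_pmf.prob (play A adv buy n (initial_mem n \<delta> \<beta> B) T)
        {(h, m). real (mistakes h) \<le>
           C * (real n ^ 2 * ln (1 / \<delta>) + real n * sqrt (ln (1 / \<beta>) * ln (1 / \<delta>)))}
        \<ge> 1 - \<beta>"
\<comment> \<open>The polynomial is \<open>100 * (s + 1)^2\<close>, which dominates the bound
  \<open>100 * (n + 1)^2\<close> because both logarithms are nonnegative.\<close>
proof (intro exI[of _ "(predict_com, update_com)"] exI[of _ "[:100, 200, 100:]"] exI[of _ 24]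
    allI impI conjI)
  fix n :: nat and \<delta> \<beta> B :: real and v :: vec
    and buy :: "vec \<Rightarrow> vec" and adv :: "history \<Rightarrow> vec" and T t :: nat
  assume \<delta>: "0 < \<delta>" "\<delta> < 1" "1 / \<delta> \<in> \<nat>" and \<beta>: "0 < \<beta>" "\<beta> < 1"
    and v: "v \<in> valuations n \<delta>"
    and buy: "\<forall>p \<in> cube n. purchased n v B p (buy p)" and adv: "\<forall>h. adv h \<in> cube n"
  note play = play_learned[OF v \<delta>(1) buy adv]
  have ln: "0 \<le> ln (1 / \<delta>)" "0 \<le> ln (1 / \<beta>)" using \<delta> \<beta> by simp_all
  show "round_time_le (nat \<lfloor>poly [:100, 200, 100:] (real n + ln (1 / \<delta>) + ln (1 / \<beta>))\<rfloor>)
    (predict_com, update_com) adv buy n (initial_mem n \<delta> \<beta> B) t"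
  proof -
    let ?s = "real n + ln (1 / \<delta>) + ln (1 / \<beta>)"
    have "real (100 * (n + 1)\<^sup>2) = 100 * (real n + 1)\<^sup>2" by simp
    also have "\<dots> \<le> 100 * (?s + 1)\<^sup>2" using ln by (intro mult_left_mono power_mono) auto
    also have "\<dots> = poly [:100, 200, 100:] ?s" by (simp add: power2_eq_square algebra_simps)
    finally have K: "100 * (n + 1)\<^sup>2 \<le> nat \<lfloor>poly [:100, 200, 100:] ?s\<rfloor>" (is "_ \<le> ?K")
      by (rule le_nat_floor)
    obtain h m where h: "play (predict_com, update_com) adv buy n (initial_mem n \<delta> \<beta> B) t = return_pmf (h, m)"
      "learned n \<delta> B v h m" using play by blast
    have p: "adv h \<in> cube n" "purchased n v B (adv h) (buy (adv h))" using buy adv by auto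
    from learned_round[OF v \<delta>(1) p h(2)] obtain m1 where
      "exec predict_com (write_vec 1 (adv h) m) = return_pmf m1"
      "halts_within (100 * (n + 1)\<^sup>2) predict_com (write_vec 1 (adv h) m)"
      "halts_within (100 * (n + 1)\<^sup>2) update_com (write_vec 3 (buy (adv h)) m1)" by metis
    then show ?thesis using h(1) halts_within_mono[OF _ K] by (simp add: round_time_le_def)
  qed
  show "measure_pmf.prob (play (predict_com, update_com) adv buy n (initial_mem n \<delta> \<beta> B) T)
      {(h, m). real (mistakes h) \<le>
         24 * (real n ^ 2 * ln (1 / \<delta>) + real n * sqrt (ln (1 / \<beta>) * ln (1 / \<delta>)))}
    \<ge> 1 - \<beta>"
  proof -
    obtain h m where h: "play (predict_com, update_com) adv buy n (initial_mem n \<delta> \<beta> B) T = return_pmf (h, m)"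
      "learned n \<delta> B v h m" using play by blast
    have "0 \<le> real n * sqrt (ln (1 / \<beta>) * ln (1 / \<delta>))" using ln by simp
    then have "real (mistakes h) \<le>
        24 * (real n ^ 2 * ln (1 / \<delta>) + real n * sqrt (ln (1 / \<beta>) * ln (1 / \<delta>)))"
      using learned_mistakes[OF v \<delta> h(2)] by (simp add: distrib_left del: real_sqrt_mult)
    then show ?thesis using \<beta> by (simp add: h(1))
  qed
qed

end
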